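(* (1) The $\mathsf{PA}$-based Smullyan model $M_{\mathsf{PA}}$ does not satisfy T-Tarski$^+$; that is, there is $H\in\mathrm{Pred}$ with $\mathrm{True}_{M_{\mathsf{PA}}}^+=\Phi_{\mathsf{PA}}(H)\cap\mathrm{Sent}^+$. (2) $M_{\mathsf{PA}}$ satisfies T-Tarski; that is, there is no $H\in\mathrm{Pred}$ with $\Phi_{\mathsf{PA}}(H)=\mathrm{True}_{M_{\mathsf{PA}}}$.
   Context: Arithmetic. $\mathcal{L}_A$ is the language of first-order arithmetic, containing a function symbol for each primitive recursive function. $\mathsf{PA}$ (Peano arithmetic) is the $\mathcal{L}_A$-theory consisting of the basic axioms of arithmetic (including defining equations of the primitive recursive function symbols) and the induction scheme. $\overline{n}$ is the numeral of $n$. Fix a natural Gödel numbering; $\ulcorner\psi\urcorner$ is the Gödel number of $\psi$, and inside formulas also its numeral. Fix a variable $v$. A $v$-formula is an $\mathcal{L}_A$-formula with no free variables other than $v$ (possibly none); $\varphi_i(v)$ is the $v$-formula with Gödel number $i$; $\Gamma$ is the set of Gödel numbers of $v$-formulas; $\psi(t)$ is the result of substituting the term $t$ for $v$ in $\psi(v)$. $d$ is the primitive recursive function (and its function symbol) with $d(i)=\ulcorner\varphi_i(\overline{i})\urcorner$ if $i\in\Gamma$ and $d(i)=0$ otherwise. $\equiv$ is syntactic identity. Frame. Let $\mathsf{r},a_i$ $(i\in\Gamma)$ be pairwise distinct symbols, $\Sigma=\{a_i: i\in\Gamma\}\cup\{\mathsf{r}\}$, $\Sigma^\ast$ the set of finite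 strings over $\Sigma$ (including the empty string $\epsilon$), $\mathrm{Pred}=\{\mathsf{r}^ja_i: j\in\mathbb{N}, i\in\Gamma\}$, $\mathrm{Sent}=\{HX: H\in\mathrm{Pred}, X\in\Sigma^\ast\}$ (the decomposition $HX$ is unique), $\mathrm{Sent}^+=\mathrm{Sent}\setminus\mathrm{Pred}$. Map $I$ from $\mathrm{Pred}$ to $v$-formulas: $I(a_i)\equiv\varphi_i(v)$; $I(\mathsf{r}a_i)\equiv\varphi_i(d(v))$; $I(\mathsf{r}^ja_i)\equiv\bot$ for $j\ge2$. Map $J$ from $\mathrm{Sent}$ to $\mathcal{L}_A$-sentences, defined inductively for $H\in\mathrm{Pred}$, $X\in\Sigma^\ast$: if $X\in\mathrm{Pred}$, $J(HX)\equiv I(H)(\ulcorner I(X)(v)\urcorner)$; if $X\notin\mathrm{Sent}$, $J(a_iX)\equiv I(a_i)(0)$ and $J(\mathsf{r}HX)\equiv\bot$; if $X\in\mathrm{Sent}^+$, $J(a_iX)\equiv I(a_i)(\ulcorner J(X)\urcorner)$ and $J(\mathsf{r}HX)\equiv\bot$. Model. $M_{\mathsf{PA}}=(\Sigma,\mathrm{Pred},\Phi_{\mathsf{PA}})$ with $\Phi_{\mathsf{PA}}(H)=\{X\in\Sigma^\ast: \mathsf{PA}\vdash J(HX)\}$. $\mathrm{True}_{M_{\mathsf{PA}}}=\{HX: H\in\mathrm{Pred}, X\in\Phi_{\mathsf{PA}}(H)\}$ and $\mathrm{True}_{M_{\mathsf{PA}}}^+=\mathrm{True}_{M_{\mathsf{PA}}}\cap\mathrm{Sent}^+$.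 *)

theory Defs
  imports Main "HOL-Library.Nat_Bijection"
begin

section \<open>Primitive recursive function symbols\<close>

text \<open>The function symbols of the language are the primitive recursive definitions: every
  primitive recursive function is denoted by at least one symbol.  The first argument of
  \<^term>\<open>Comp\<close> is the arity of the composite, needed when the list of inner functions is empty.
  \<^term>\<open>Rec\<close> recurses on the first argument.\<close>

datatype prsym = Zero | Succ | Proj nat nat | Comp nat prsym "prsym list" | Rec prsym prsym

fun ar :: "prsym \<Rightarrow> nat" where
  "ar Zero = 0"
| "ar Succ = 1"
| "ar (Proj n i) = n"
| "ar (Comp n g hs) = n"
| "ar (Rec g h) = Suc (ar g)"

fun wf_sym :: "prsym \<Rightarrow> bool" where
  "wf_sym Zero = True"
| "wf_sym Succ = True"
| "wf_sym (Proj n i) = (i < n)"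
| "wf_sym (Comp n g hs) =
     (wf_sym g \<and> ar g = length hs \<and> (\<forall>h\<in>set hs. wf_sym h \<and> ar h = n))"
| "wf_sym (Rec g h) = (wf_sym g \<and> wf_sym h \<and> ar h = ar g + 2)"

text \<open>The function denoted by a symbol; only meaningful for a well-formed symbol applied to a list
  whose length is the arity.\<close>

fun pr_eval :: "prsym \<Rightarrow> nat list \<Rightarrow> nat" where
  "pr_eval Zero xs = 0"
| "pr_eval Succ xs = Suc (hd xs)"
| "pr_eval (Proj n i) xs = xs ! i"
| "pr_eval (Comp n g hs) xs = pr_eval g (map (\<lambda>h. pr_eval h xs) hs)"
| "pr_eval (Rec g h) xs =
     rec_nat (pr_eval g (tl xs)) (\<lambda>y r. pr_eval h (y # r # tl xs)) (hd xs)"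


section \<open>Terms and formulas\<close>

datatype trm = Var nat | Fn prsym "trm list"

datatype fm = Bot | Eq trm trm | Imp fm fm | All nat fm

fun wf_trm :: "trm \<Rightarrow> bool" where
  "wf_trm (Var x) = True"
| "wf_trm (Fn f ts) = (wf_sym f \<and> length ts = ar f \<and> (\<forall>t\<in>set ts. wf_trm t))"

fun wf_fm :: "fm \<Rightarrow> bool" where
  "wf_fm Bot = True"
| "wf_fm (Eq s t) = (wf_trm s \<and> wf_trm t)"
| "wf_fm (Imp A B) = (wf_fm A \<and> wf_fm B)"
| "wf_fm (All x A) = wf_fm A"

fun fv_trm :: "trm \<Rightarrow> nat set" where
  "fv_trm (Var x) = {x}"
| "fv_trm (Fn f ts) = (\<Union>t\<in>set ts. fv_trm t)"

fun fv :: "fm \<Rightarrow> nat set" where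
  "fv Bot = {}"
| "fv (Eq s t) = fv_trm s \<union> fv_trm t"
| "fv (Imp A B) = fv A \<union> fv B"
| "fv (All x A) = fv A - {x}"

fun subst_trm :: "nat \<Rightarrow> trm \<Rightarrow> trm \<Rightarrow> trm" where
  "subst_trm x u (Var y) = (if y = x then u else Var y)"
| "subst_trm x u (Fn f ts) = Fn f (map (subst_trm x u) ts)"

text \<open>\<open>subst x u A\<close> replaces the free occurrences of \<open>x\<close> in \<open>A\<close> by \<open>u\<close>, without renaming bound
  variables.\<close>

fun subst :: "nat \<Rightarrow> trm \<Rightarrow> fm \<Rightarrow> fm" where
  "subst x u Bot = Bot"
| "subst x u (Eq s t) = Eq (subst_trm x u s) (subst_trm x u t)"
| "subst x u (Imp A B) = Imp (subst x u A) (subst x u B)"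
| "subst x u (All y A) = (if y = x then All y A else All y (subst x u A))"

fun free_for :: "trm \<Rightarrow> nat \<Rightarrow> fm \<Rightarrow> bool" where
  "free_for u x Bot = True"
| "free_for u x (Eq s t) = True"
| "free_for u x (Imp A B) = (free_for u x A \<and> free_for u x B)"
| "free_for u x (All y A) = (x \<notin> fv (All y A) \<or> (y \<notin> fv_trm u \<and> free_for u x A))"

fun num :: "nat \<Rightarrow> trm" where
  "num 0 = Fn Zero []"
| "num (Suc n) = Fn Succ [num n]"


section \<open>Provability\<close>

text \<open>A Hilbert calculus for classical first-order logic with equality.  Axioms may be open
  formulas; by generalization this amounts to postulating their universal closures.\<close>

inductive provable :: "fm set \<Rightarrow> fm \<Rightarrow> bool" (infix "\<turnstile>" 50) for T :: "fm set" where
  Ax: "A \<in> T \<Longrightarrow> T \<turnstile> A"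
| K: "wf_fm A \<Longrightarrow> wf_fm B \<Longrightarrow> T \<turnstile> Imp A (Imp B A)"
| S: "wf_fm A \<Longrightarrow> wf_fm B \<Longrightarrow> wf_fm C \<Longrightarrow>
      T \<turnstile> Imp (Imp A (Imp B C)) (Imp (Imp A B) (Imp A C))"
| DN: "wf_fm A \<Longrightarrow> T \<turnstile> Imp (Imp (Imp A Bot) Bot) A"
| AllE: "wf_fm A \<Longrightarrow> wf_trm t \<Longrightarrow> free_for t x A \<Longrightarrow> T \<turnstile> Imp (All x A) (subst x t A)"
| AllD: "wf_fm A \<Longrightarrow> wf_fm B \<Longrightarrow> x \<notin> fv A \<Longrightarrow>
      T \<turnstile> Imp (All x (Imp A B)) (Imp A (All x B))"
| Refl: "wf_trm t \<Longrightarrow> T \<turnstile> Eq t t"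
| Leibniz: "wf_fm A \<Longrightarrow> wf_trm s \<Longrightarrow> wf_trm t \<Longrightarrow> free_for s x A \<Longrightarrow> free_for t x A \<Longrightarrow>
      T \<turnstile> Imp (Eq s t) (Imp (subst x s A) (subst x t A))"
| MP: "T \<turnstile> Imp A B \<Longrightarrow> T \<turnstile> A \<Longrightarrow> T \<turnstile> B"
| Gen: "T \<turnstile> A \<Longrightarrow> T \<turnstile> All x A"

text \<open>Addition, multiplication and order need no separate axioms: they are primitive recursive and
  are governed by their defining equations.  In the induction axiom no capture can occur: a free
  \<open>x\<close> never lies in the scope of a quantifier over \<open>x\<close>.\<close>

inductive_set PA :: "fm set" where
  succ_not_zero: "Imp (Eq (Fn Succ [Var 0]) (num 0)) Bot \<in> PA"
| succ_inj: "Imp (Eq (Fn Succ [Var 0]) (Fn Succ [Var 1])) (Eq (Var 0) (Var 1)) \<in> PA"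
| proj_eq: "wf_sym (Proj n i) \<Longrightarrow> Eq (Fn (Proj n i) (map Var [0..<n])) (Var i) \<in> PA"
| comp_eq: "wf_sym (Comp n g hs) \<Longrightarrow>
    Eq (Fn (Comp n g hs) (map Var [0..<n]))
       (Fn g (map (\<lambda>h. Fn h (map Var [0..<n])) hs)) \<in> PA"
| rec_zero: "wf_sym (Rec g h) \<Longrightarrow> xs = map Var [1..<Suc (ar g)] \<Longrightarrow>
    Eq (Fn (Rec g h) (num 0 # xs)) (Fn g xs) \<in> PA"
| rec_succ: "wf_sym (Rec g h) \<Longrightarrow> xs = map Var [1..<Suc (ar g)] \<Longrightarrow>
    Eq (Fn (Rec g h) (Fn Succ [Var 0] # xs))
       (Fn h (Var 0 # Fn (Rec g h) (Var 0 # xs) # xs)) \<in> PA"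
| induction: "wf_fm A \<Longrightarrow>
    Imp (subst x (num 0) A)
        (Imp (All x (Imp A (subst x (Fn Succ [Var x]) A))) (All x A)) \<in> PA"


section \<open>Goedel numbering\<close>

fun gn_sym :: "prsym \<Rightarrow> nat" where
  "gn_sym Zero = list_encode [0]"
| "gn_sym Succ = list_encode [1]"
| "gn_sym (Proj n i) = list_encode [2, n, i]"
| "gn_sym (Comp n g hs) = list_encode (3 # n # gn_sym g # map gn_sym hs)"
| "gn_sym (Rec g h) = list_encode [4, gn_sym g, gn_sym h]"

fun gn_trm :: "trm \<Rightarrow> nat" where
  "gn_trm (Var x) = list_encode [0, x]"
| "gn_trm (Fn f ts) = list_encode (1 # gn_sym f # map gn_trm ts)"

fun gn :: "fm \<Rightarrow> nat" where
  "gn Bot = list_encode [0]"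
| "gn (Eq s t) = list_encode [1, gn_trm s, gn_trm t]"
| "gn (Imp A B) = list_encode [2, gn A, gn B]"
| "gn (All x A) = list_encode [3, x, gn A]"

lemma gn_sym_inj: "gn_sym f = gn_sym g \<Longrightarrow> f = g"
proof (induction f arbitrary: g rule: gn_sym.induct)
  case (4 n g' hs)
  then show ?case
  proof (cases g)
    case (Comp m k ks)
    with "4.prems" have e: "n = m" "gn_sym g' = gn_sym k" "map gn_sym hs = map gn_sym ks"
      by (simp_all add: list_encode_eq del: list_encode.simps)
    from e(3) have "hs = ks"
      by (rule list.inj_map_strong[rotated]) (use "4.IH"(2) in blast)
    then show ?thesis using e "4.IH"(1) Comp by blast
  qed (simp_all add: list_encode_eq del: list_encode.simps)
next
  case (5 a b)
  then show ?case
    by (cases g) (simp_all add: list_encode_eq del: list_encode.simps)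
qed (case_tac g; simp add: list_encode_eq del: list_encode.simps)+

lemma gn_trm_inj: "gn_trm s = gn_trm t \<Longrightarrow> s = t"
proof (induction s arbitrary: t rule: gn_trm.induct)
  case (1 x)
  then show ?case by (cases t) (simp_all add: list_encode_eq del: list_encode.simps)
next
  case (2 f ss)
  then show ?case
  proof (cases t)
    case (Fn g ts)
    with "2.prems" have e: "gn_sym f = gn_sym g" "map gn_trm ss = map gn_trm ts"
      by (simp_all add: list_encode_eq del: list_encode.simps)
    from e(2) have "ss = ts"
      by (rule list.inj_map_strong[rotated]) (use "2.IH" in blast)
    then show ?thesis using e gn_sym_inj Fn by blast
  qed (simp_all add: list_encode_eq del: list_encode.simps)
qed

lemma gn_inj: "gn A = gn B \<Longrightarrow> A = B"
proof (induction A arbitrary: B)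
  case Bot
  then show ?case by (cases B) (simp_all add: list_encode_eq del: list_encode.simps)
next
  case (Eq s t)
  then show ?case
    by (cases B) (auto simp add: list_encode_eq gn_trm_inj simp del: list_encode.simps)
next
  case (Imp A1 A2)
  then show ?case by (cases B) (auto simp add: list_encode_eq simp del: list_encode.simps)
next
  case (All x A)
  then show ?case by (cases B) (auto simp add: list_encode_eq simp del: list_encode.simps)
qed


section \<open>\<open>v\<close>-formulas and the diagonal function\<close>

abbreviation var_v :: nat where "var_v \<equiv> 0"

definition vformula :: "fm \<Rightarrow> bool" where
  "vformula A \<longleftrightarrow> wf_fm A \<and> fv A \<subseteq> {var_v}"

definition \<Gamma> :: "nat set" where
  "\<Gamma> = gn ` {A. vformula A}"

definition phi :: "nat \<Rightarrow> fm" where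
  "phi i = (THE A. vformula A \<and> gn A = i)"

lemma phi_gn [simp]: "vformula A \<Longrightarrow> phi (gn A) = A"
  unfolding phi_def by (rule the_equality) (auto dest: gn_inj)

lemma phi_Gamma: "i \<in> \<Gamma> \<Longrightarrow> vformula (phi i) \<and> gn (phi i) = i"
  by (auto simp: \<Gamma>_def)

abbreviation inst :: "fm \<Rightarrow> trm \<Rightarrow> fm" where
  "inst A t \<equiv> subst var_v t A"

definition diag :: "nat \<Rightarrow> nat" where
  "diag i = (if i \<in> \<Gamma> then gn (inst (phi i) (num i)) else 0)"

text \<open>A symbol for \<^term>\<open>diag\<close>.  The function \<^term>\<open>diag\<close> is primitive recursive, so such a symbol
  exists; since symbols are definitions it is not unique, and one of them is fixed.\<close>

definition diag_sym :: prsym where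
  "diag_sym = (SOME f. wf_sym f \<and> ar f = 1 \<and> (\<forall>i. pr_eval f [i] = diag i))"


section \<open>Smullyan models\<close>

record 's smullyan_model =
  alphabet :: "'s set"
  Pred :: "'s list set"
  Phi :: "'s list \<Rightarrow> 's list set"

definition Sent :: "'s smullyan_model \<Rightarrow> 's list set" where
  "Sent M = {H @ X | H X. H \<in> Pred M \<and> X \<in> lists (alphabet M)}"

definition Sent_plus :: "'s smullyan_model \<Rightarrow> 's list set" where
  "Sent_plus M = Sent M - Pred M"

definition True_set :: "'s smullyan_model \<Rightarrow> 's list set" where
  "True_set M = {H @ X | H X. H \<in> Pred M \<and> X \<in> Phi M H}"

definition True_plus :: "'s smullyan_model \<Rightarrow> 's list set" where
  "True_plus M = True_set M \<inter> Sent_plus M"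

definition T_Tarski :: "'s smullyan_model \<Rightarrow> bool" where
  "T_Tarski M \<longleftrightarrow> \<not> (\<exists>H\<in>Pred M. Phi M H = True_set M)"

definition T_Tarski_plus :: "'s smullyan_model \<Rightarrow> bool" where
  "T_Tarski_plus M \<longleftrightarrow> \<not> (\<exists>H\<in>Pred M. True_plus M = Phi M H \<inter> Sent_plus M)"


section \<open>The \<open>PA\<close>-based model\<close>

text \<open>Only the letters \<open>LetA i\<close> with \<open>i \<in> \<Gamma>\<close> belong to the alphabet.\<close>

datatype letter = LetR | LetA nat

definition Sigma_PA :: "letter set" where
  "Sigma_PA = LetA ` \<Gamma> \<union> {LetR}"

definition Pred_PA :: "letter list set" where
  "Pred_PA = {replicate j LetR @ [LetA i] | j i. i \<in> \<Gamma>}"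

definition Sent_PA :: "letter list set" where
  "Sent_PA = {H @ X | H X. H \<in> Pred_PA \<and> X \<in> lists Sigma_PA}"

text \<open>\<open>I_PA\<close> is only relevant on \<^term>\<open>Pred_PA\<close>, where the last equation covers exactly the predicates
  with at least two leading \<^term>\<open>LetR\<close>.\<close>

fun I_PA :: "letter list \<Rightarrow> fm" where
  "I_PA [LetA i] = phi i"
| "I_PA [LetR, LetA i] = inst (phi i) (Fn diag_sym [Var var_v])"
| "I_PA _ = Bot"

text \<open>The decomposition of a sentence into its leading predicate and the rest.\<close>

fun split_pred :: "letter list \<Rightarrow> letter list \<times> letter list" where
  "split_pred [] = ([], [])"
| "split_pred (LetA i # X) = ([LetA i], X)"
| "split_pred (LetR # w) = (case split_pred w of (H, X) \<Rightarrow> (LetR # H, X))"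

text \<open>Only relevant on \<^term>\<open>Sent_PA\<close>; the lemmas below are the equations that characterize it.\<close>

fun J_PA :: "letter list \<Rightarrow> fm" where
  "J_PA [] = Bot"
| "J_PA (LetA i # X) =
     (if X \<in> Pred_PA then inst (I_PA [LetA i]) (num (gn (I_PA X)))
      else if X \<in> Sent_PA then inst (I_PA [LetA i]) (num (gn (J_PA X)))
      else inst (I_PA [LetA i]) (num 0))"
| "J_PA (LetR # w) =
     (case split_pred w of (H, X) \<Rightarrow>
        if X \<in> Pred_PA then inst (I_PA (LetR # H)) (num (gn (I_PA X))) else Bot)"

lemma split_pred_append: "H \<in> Pred_PA \<Longrightarrow> split_pred (H @ X) = (H, X)"
proof -
  have "split_pred ((replicate j LetR @ [LetA i]) @ X) = (replicate j LetR @ [LetA i], X)" for j i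
    by (induction j) auto
  then show "H \<in> Pred_PA \<Longrightarrow> split_pred (H @ X) = (H, X)"
    unfolding Pred_PA_def by blast
qed

lemma decomposition_unique:
  assumes "H \<in> Pred_PA" "H' \<in> Pred_PA" "H @ X = H' @ X'"
  shows "H = H' \<and> X = X'"
  using assms by (metis split_pred_append prod.inject)

lemma J_Pred:
  assumes "H \<in> Pred_PA" "X \<in> Pred_PA"
  shows "J_PA (H @ X) = inst (I_PA H) (num (gn (I_PA X)))"
proof -
  from assms(1) obtain j i where H: "H = replicate j LetR @ [LetA i]"
    by (auto simp: Pred_PA_def)
  show ?thesis
  proof (cases j)
    case 0
    then show ?thesis using H assms(2) by simp
  next
    case (Suc k)
    have "split_pred ((replicate k LetR @ [LetA i]) @ X) = (replicate k LetR @ [LetA i], X)"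
      by (induction k) auto
    then show ?thesis using H Suc assms(2) by simp
  qed
qed

lemma J_not_Sent:
  assumes "X \<notin> Sent_PA"
  shows "J_PA (LetA i # X) = inst (I_PA [LetA i]) (num 0)"
    and "H \<in> Pred_PA \<Longrightarrow> J_PA (LetR # H @ X) = Bot"
proof -
  have "Pred_PA \<subseteq> Sent_PA"
    by (force simp: Sent_PA_def)
  with assms have "X \<notin> Pred_PA" by blast
  with assms show "J_PA (LetA i # X) = inst (I_PA [LetA i]) (num 0)"
    and "H \<in> Pred_PA \<Longrightarrow> J_PA (LetR # H @ X) = Bot"
    by (simp_all add: split_pred_append)
qed

lemma J_Sent_plus:
  assumes "X \<in> Sent_PA - Pred_PA"
  shows "J_PA (LetA i # X) = inst (I_PA [LetA i]) (num (gn (J_PA X)))"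
    and "H \<in> Pred_PA \<Longrightarrow> J_PA (LetR # H @ X) = Bot"
  using assms by (simp_all add: split_pred_append)

definition Phi_PA :: "letter list \<Rightarrow> letter list set" where
  "Phi_PA H = {X \<in> lists Sigma_PA. PA \<turnstile> J_PA (H @ X)}"

definition M_PA :: "letter smullyan_model" where
  "M_PA = \<lparr>alphabet = Sigma_PA, Pred = Pred_PA, Phi = Phi_PA\<rparr>"

lemma Sent_M_PA: "Sent M_PA = Sent_PA"
  by (simp add: Sent_def Sent_PA_def M_PA_def)

end

theory Submission
  imports Defs
begin

text \<open>For T-Tarski, take the true sentence \<open>0 = 0\<close> as a \<open>v\<close>-formula with letter \<open>a\<close>.  As \<open>v\<close> does
  not occur in it, \<open>I(r a) = I(a)\<close>, so no predicate \<open>a\<^sub>i\<close> can separate the strings \<open>a\<close> and \<open>r a\<close>,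
  whereas only the first is true.  The remaining predicates hold at most of the elements of
  \<^const>\<open>Pred_PA\<close>, but \<open>a a\<close> is true.

  T-Tarski\<open>\<^sup>+\<close> fails at \<open>a\<^sub>i\<close> when \<open>\<phi>\<^sub>i\<close> is a provability predicate \<open>\<exists>t. f(t, v) = 1\<close> for a primitive
  recursive \<open>f\<close>: \<open>PA\<close> evaluates its function symbols on numerals and is sound in the standard model,
  so it proves \<open>\<phi>\<^sub>i\<close> at the code of \<open>A\<close> iff it proves \<open>A\<close>.  To obtain \<open>f\<close>, syntax and provability are
  described by inductive definitions on codes, and the least fixed point of every operator of a
  suitable syntactic class is recursively enumerable.\<close>

section \<open>Primitive recursive functions\<close>

text \<open>Tuples will be coded as single numbers, so unary functions are the main objects;
  \<open>pr2\<close> supplies binary building blocks such as addition and pairing.\<close>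

definition pr :: "(nat \<Rightarrow> nat) \<Rightarrow> bool" where
  "pr f \<longleftrightarrow> (\<exists>s. wf_sym s \<and> ar s = 1 \<and> (\<forall>x. pr_eval s [x] = f x))"

definition pr2 :: "(nat \<Rightarrow> nat \<Rightarrow> nat) \<Rightarrow> bool" where
  "pr2 f \<longleftrightarrow> (\<exists>s. wf_sym s \<and> ar s = 2 \<and> (\<forall>x y. pr_eval s [x, y] = f x y))"

section \<open>Composition, iteration and elementary arithmetic\<close>

lemma pr2_fst: "pr2 (\<lambda>x y. x)" and pr2_snd: "pr2 (\<lambda>x y. y)"
  unfolding pr2_def by (rule exI[of _ "Proj 2 0"], simp) (rule exI[of _ "Proj 2 1"], simp)

lemma pr_id: "pr (\<lambda>x. x)"
  unfolding pr_def by (rule exI[of _ "Proj 1 0"]) simp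

lemma pr_comp: "pr g \<Longrightarrow> pr f \<Longrightarrow> pr (\<lambda>x. g (f x))"
proof -
  assume "pr g" "pr f"
  then obtain s t where "wf_sym s" "ar s = 1" "\<And>x. pr_eval s [x] = g x"
    "wf_sym t" "ar t = 1" "\<And>x. pr_eval t [x] = f x"
    unfolding pr_def by blast
  then show ?thesis
    unfolding pr_def by (intro exI[of _ "Comp 1 s [t]"]) simp
qed

lemma pr_comp2: "pr2 g \<Longrightarrow> pr f1 \<Longrightarrow> pr f2 \<Longrightarrow> pr (\<lambda>x. g (f1 x) (f2 x))"
proof -
  assume "pr2 g" "pr f1" "pr f2"
  then obtain s t u where "wf_sym s" "ar s = 2" "\<And>x y. pr_eval s [x, y] = g x y"
    "wf_sym t" "ar t = 1" "\<And>x. pr_eval t [x] = f1 x"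
    "wf_sym u" "ar u = 1" "\<And>x. pr_eval u [x] = f2 x"
    unfolding pr_def pr2_def by blast
  then show ?thesis
    unfolding pr_def by (intro exI[of _ "Comp 1 s [t, u]"]) simp
qed

lemma pr2_comp: "pr g \<Longrightarrow> pr2 f \<Longrightarrow> pr2 (\<lambda>x y. g (f x y))"
proof -
  assume "pr g" "pr2 f"
  then obtain s t where "wf_sym s" "ar s = 1" "\<And>x. pr_eval s [x] = g x"
    "wf_sym t" "ar t = 2" "\<And>x y. pr_eval t [x, y] = f x y"
    unfolding pr_def pr2_def by blast
  then show ?thesis
    unfolding pr2_def by (intro exI[of _ "Comp 2 s [t]"]) simp
qed

lemma pr2_comp2: "pr2 g \<Longrightarrow> pr2 f1 \<Longrightarrow> pr2 f2 \<Longrightarrow> pr2 (\<lambda>x y. g (f1 x y) (f2 x y))"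
proof -
  assume "pr2 g" "pr2 f1" "pr2 f2"
  then obtain s t u where "wf_sym s" "ar s = 2" "\<And>x y. pr_eval s [x, y] = g x y"
    "wf_sym t" "ar t = 2" "\<And>x y. pr_eval t [x, y] = f1 x y"
    "wf_sym u" "ar u = 2" "\<And>x y. pr_eval u [x, y] = f2 x y"
    unfolding pr2_def by blast
  then show ?thesis
    unfolding pr2_def by (intro exI[of _ "Comp 2 s [t, u]"]) simp
qed

lemma pr_Suc': "pr Suc"
  unfolding pr_def by (rule exI[of _ Succ]) simp

lemmas pr_Suc = pr_comp[OF pr_Suc']

lemma pr_const: "pr (\<lambda>x. c)"
proof (induction c)
  case 0
  show ?case unfolding pr_def by (rule exI[of _ "Comp 1 Zero []"]) simp
next
  case (Suc c)
  then show ?case by (rule pr_Suc)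
qed

text \<open>Recursion without parameters: \<open>Zero\<close> has arity \<open>0\<close>, so
  \<open>Rec Zero s\<close> is unary. This is enough to build the inverse of pairing, on which
  recursion with a parameter rests below.\<close>

lemma pr_rec_nat_0: "pr2 h \<Longrightarrow> pr (rec_nat 0 h)"
proof -
  assume "pr2 h"
  then obtain s where "wf_sym s" "ar s = 2" "\<And>x y. pr_eval s [x, y] = h x y"
    unfolding pr2_def by blast
  then show ?thesis
    unfolding pr_def by (intro exI[of _ "Rec Zero s"]) simp
qed

lemma pr2_iterate: "pr f \<Longrightarrow> pr2 (\<lambda>n x. (f ^^ n) x)"
proof -
  assume "pr f"
  then obtain s where s: "wf_sym s" "ar s = 1" "\<And>x. pr_eval s [x] = f x"
    unfolding pr_def by blast
  \<comment> \<open>The step symbol receives the counter, the previous value and the parameter; it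
    applies \<open>s\<close> to the previous value.\<close>
  let ?r = "Rec (Proj 1 0) (Comp 3 s [Proj 3 1])"
  have "pr_eval ?r [n, x] = (f ^^ n) x" for n x
    by (induction n) (use s in simp_all)
  with s show ?thesis
    unfolding pr2_def by (intro exI[of _ ?r]) (simp add: numeral_3_eq_3)
qed

lemma pr2_add: "pr2 (+)"
proof -
  have "(Suc ^^ n) x = n + x" for n x by (induction n) simp_all
  with pr2_iterate[OF pr_Suc'] show ?thesis by simp
qed

lemma pr2_diff: "pr2 (-)"
proof -
  \<comment> \<open>Predecessor, as a recursion whose step returns the counter; its value at
    \<open>0\<close> is \<open>0\<close>.\<close>
  have "rec_nat 0 (\<lambda>x y. x) n = n - 1" for n by (cases n) simp_all
  then have "pr (\<lambda>n. n - 1)"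
    using pr_rec_nat_0[OF pr2_fst] by presburger
  from pr2_iterate[OF this] have "pr2 (\<lambda>n x. ((\<lambda>n. n - 1) ^^ n) x)" .
  moreover have "((\<lambda>n. n - 1) ^^ n) x = x - n" for n x :: nat by (induction n) simp_all
  ultimately have "pr2 (\<lambda>n x. x - n)" by (simp only:)
  from this obtain s where "wf_sym s" "ar s = 2" "\<And>x y. pr_eval s [x, y] = y - x"
    unfolding pr2_def by blast
  then show ?thesis
    \<comment> \<open>Iteration takes the number of steps first, which is the subtrahend, so the
      arguments are swapped.\<close>
    unfolding pr2_def by (intro exI[of _ "Comp 2 s [Proj 2 1, Proj 2 0]"]) simp
qed

lemmas pr_add = pr_comp2[OF pr2_add]
lemmas pr_diff = pr_comp2[OF pr2_diff]

lemma pr_triangle': "pr triangle"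
proof -
  have "pr (rec_nat 0 (\<lambda>y r. r + Suc y))"
    by (intro pr_rec_nat_0 pr2_comp2[OF pr2_add] pr2_comp[OF pr_Suc'] pr2_fst pr2_snd)
  moreover have "rec_nat 0 (\<lambda>y r. r + Suc y) = triangle"
  proof
    show "rec_nat 0 (\<lambda>y r. r + Suc y) n = triangle n" for n by (induction n) simp_all
  qed
  ultimately show ?thesis by simp
qed

lemmas pr_triangle = pr_comp[OF pr_triangle']

lemma pr2_const: "pr2 (\<lambda>x y. c)"
  by (rule pr2_comp[OF pr_const pr2_fst])

section \<open>Pairing, its inverse, and recursion with a parameter\<close>

definition pfst :: "nat \<Rightarrow> nat" where "pfst n = fst (prod_decode n)"
definition psnd :: "nat \<Rightarrow> nat" where "psnd n = snd (prod_decode n)"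

lemma pfst_encode [simp]: "pfst (prod_encode (a, b)) = a"
  and psnd_encode [simp]: "psnd (prod_encode (a, b)) = b"
  by (simp_all add: pfst_def psnd_def)

text \<open>\<open>troot n\<close> is the index of the antidiagonal on which the pair coded by \<open>n\<close> lies.  The increment
  is \<open>1\<close> exactly when \<open>Suc n\<close> is the first code on the next antidiagonal.\<close>

definition troot :: "nat \<Rightarrow> nat" where
  "troot = rec_nat 0 (\<lambda>n r. r + (1 - (triangle (Suc r) - Suc n)))"

lemma troot_bounds: "triangle (troot n) \<le> n \<and> n < triangle (Suc (troot n))"
proof (induction n)
  case 0
  then show ?case by (simp add: troot_def)
next
  case (Suc n)
  have "troot (Suc n) = troot n + (1 - (triangle (Suc (troot n)) - Suc n))"
    by (simp add: troot_def)
  then show ?case using Suc by (cases "Suc n = triangle (Suc (troot n))") auto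
qed

text \<open>As \<open>prod_encode (a, b)\<close> is \<open>triangle (a + b) + a\<close>, the offset
  of \<open>n\<close> on its antidiagonal is the first component, and subtracting it from the index
  of the antidiagonal leaves the second.\<close>

lemma prod_decode_troot:
  "prod_decode n = (n - triangle (troot n), troot n - (n - triangle (troot n)))"
proof -
  have "n = prod_encode (n - triangle (troot n), troot n - (n - triangle (troot n)))"
    using troot_bounds[of n] by (simp add: prod_encode_def)
  then show ?thesis by (metis prod_encode_inverse)
qed

lemma pr_troot': "pr troot"
  unfolding troot_def
  by (intro pr_rec_nat_0 pr2_comp2[OF pr2_add] pr2_comp2[OF pr2_diff] pr2_comp[OF pr_Suc']
      pr2_comp[OF pr_triangle'] pr2_const pr2_fst pr2_snd)

lemmas pr_troot = pr_comp[OF pr_troot']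

lemma pr_pfst': "pr pfst" and pr_psnd': "pr psnd"
  unfolding pfst_def[abs_def] psnd_def[abs_def] prod_decode_troot fst_conv snd_conv
  by (intro pr_diff pr_triangle pr_troot pr_id)+

lemmas pr_pfst = pr_comp[OF pr_pfst']
lemmas pr_psnd = pr_comp[OF pr_psnd']

lemma pr2_prod_encode: "pr2 (\<lambda>x y. prod_encode (x, y))"
  unfolding prod_encode_def prod.case
  by (intro pr2_comp2[OF pr2_add] pr2_comp[OF pr_triangle'] pr2_fst pr2_snd)

lemmas pr_prod_encode = pr_comp2[OF pr2_prod_encode]

text \<open>The step function has three arguments, so its primitive recursiveness is expressed on
  coded triples of counter, previous value and parameter.\<close>

lemma pr_rec_nat:
  assumes "pr g" "pr k" "pr (\<lambda>e. h (pfst e) (pfst (psnd e)) (psnd (psnd e)))"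
  shows "pr (\<lambda>x. rec_nat (g x) (\<lambda>y r. h y r x) (k x))"
proof -
  from assms pr2_prod_encode obtain G K H P where
    G: "wf_sym G" "ar G = 1" "\<And>x. pr_eval G [x] = g x" and
    K: "wf_sym K" "ar K = 1" "\<And>x. pr_eval K [x] = k x" and
    H: "wf_sym H" "ar H = 1"
      "\<And>e. pr_eval H [e] = h (pfst e) (pfst (psnd e)) (psnd (psnd e))" and
    P: "wf_sym P" "ar P = 2" "\<And>x y. pr_eval P [x, y] = prod_encode (x, y)"
    unfolding pr_def pr2_def by metis
  show ?thesis
    unfolding pr_def
    \<comment> \<open>The nested \<open>P\<close> terms pack the three arguments of the step into
      one code for \<open>H\<close>; the outer \<open>Comp 1\<close> supplies the recursion length
      \<open>k x\<close> and the parameter \<open>x\<close>.\<close>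
    by (rule exI[of _ "Comp 1 (Rec G (Comp 3 H [Comp 3 P [Proj 3 0, Comp 3 P [Proj 3 1, Proj 3 2]]]))
        [K, Proj 1 0]"]) (simp add: G K H P numeral_2_eq_2 numeral_3_eq_3)
qed

section \<open>Primitive recursive predicates, case distinction and bit codes\<close>

definition prp :: "(nat \<Rightarrow> bool) \<Rightarrow> bool" where
  "prp P \<longleftrightarrow> pr (\<lambda>x. of_bool (P x))"

text \<open>A case distinction is a recursion of length \<open>of_bool (P x)\<close>: without a step
  the value stays \<open>g x\<close>, and one step replaces it by \<open>f x\<close>.\<close>

lemma pr_if:
  assumes "prp P" "pr f" "pr g"
  shows "pr (\<lambda>x. if P x then f x else g x)"
proof -
  have "pr (\<lambda>x. rec_nat (g x) (\<lambda>y r. f x) (of_bool (P x)))"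
    using assms unfolding prp_def
    by (intro pr_rec_nat pr_comp[OF assms(2)] pr_psnd pr_id)
  moreover have "rec_nat (g x) (\<lambda>y r. f x) (of_bool (P x)) = (if P x then f x else g x)" for x
    by simp
  ultimately show ?thesis by (simp only:)
qed

lemma prp_not: "prp P \<Longrightarrow> prp (\<lambda>x. \<not> P x)"
proof -
  assume "prp P"
  then have "pr (\<lambda>x. 1 - of_bool (P x))"
    unfolding prp_def by (intro pr_diff pr_const)
  moreover have "1 - of_bool p = (of_bool (\<not> p) :: nat)" for p by simp
  ultimately show ?thesis unfolding prp_def by (simp only:)
qed

lemma prp_conj:
  assumes "prp P" "prp Q"
  shows "prp (\<lambda>x. P x \<and> Q x)"
proof -
  have "pr (\<lambda>x. if P x then of_bool (Q x) else 0)"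
    using assms by (intro pr_if pr_const) (simp_all add: prp_def)
  moreover have "(if p then of_bool q else 0) = (of_bool (p \<and> q) :: nat)" for p q by simp
  ultimately show ?thesis unfolding prp_def by (simp only:)
qed

lemma prp_disj:
  assumes "prp P" "prp Q"
  shows "prp (\<lambda>x. P x \<or> Q x)"
  using prp_not[OF prp_conj[OF prp_not[OF assms(1)] prp_not[OF assms(2)]]] by simp

lemma prp_le:
  assumes "pr f" "pr g"
  shows "prp (\<lambda>x. f x \<le> g x)"
proof -
  have "pr (\<lambda>x. 1 - (f x - g x))"
    using assms by (intro pr_diff pr_const)
  moreover have "1 - (f x - g x) = of_bool (f x \<le> g x)" for x by simp
  ultimately show ?thesis unfolding prp_def by (simp only:)
qed

lemma prp_less: "pr f \<Longrightarrow> pr g \<Longrightarrow> prp (\<lambda>x. f x < g x)"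
  using prp_not[OF prp_le[of g f]] by (simp add: not_le)

lemma prp_eq: "pr f \<Longrightarrow> pr g \<Longrightarrow> prp (\<lambda>x. f x = g x)"
  using prp_conj[OF prp_le[of f g] prp_le[of g f]] by (simp add: eq_iff)

lemma prp_comp: "prp P \<Longrightarrow> pr f \<Longrightarrow> prp (\<lambda>x. P (f x))"
  unfolding prp_def by (rule pr_comp)

text \<open>Halving obeys \<open>Suc n div 2 = n - n div 2\<close>, so the counter and the previous
  value determine the next value.\<close>

lemma pr_half': "pr (\<lambda>n. n div 2)"
proof -
  have "pr (rec_nat 0 (\<lambda>n r. n - r))"
    by (intro pr_rec_nat_0 pr2_diff)
  moreover have "rec_nat 0 (\<lambda>n r. n - r) = (\<lambda>n. n div 2)"
  proof
    show "rec_nat 0 (\<lambda>n r. n - r) n = n div 2" for n :: nat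
      by (induction n) auto
  qed
  ultimately show ?thesis by (simp only:)
qed

lemma pr_power_2:
  assumes "pr f"
  shows "pr (\<lambda>x. 2 ^ f x)"
proof -
  have "pr (\<lambda>x. ((\<lambda>x. x + x) ^^ f x) 1)"
    by (intro pr_comp2[OF pr2_iterate] pr_add pr_id pr_const assms)
  moreover have "((\<lambda>x. x + x) ^^ n) 1 = (2::nat) ^ n" for n by (induction n) simp_all
  ultimately show ?thesis by (simp only:)
qed

text \<open>Membership in a coded set is a bit test: halve \<open>f x\<close> times, then detect an
  odd number by comparing it with twice its half.\<close>

lemma prp_set_decode:
  assumes "pr f" "pr g"
  shows "prp (\<lambda>x. f x \<in> set_decode (g x))"
proof -
  let ?h = "\<lambda>x. ((\<lambda>n. n div 2) ^^ f x) (g x)"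
  have half: "((\<lambda>n. n div 2) ^^ k) n = n div 2 ^ k" for k n :: nat
    by (induction k) (simp_all add: div_mult2_eq[symmetric] mult.commute)
  have "prp (\<lambda>x. \<not> ?h x = ?h x div 2 + ?h x div 2)"
    by (intro prp_not prp_eq pr_add pr_comp[OF pr_half'] pr_comp2[OF pr2_iterate] pr_half' assms)
  moreover have "(\<not> n = n div 2 + n div 2) = odd n" for n :: nat by presburger
  ultimately show ?thesis by (simp add: half set_decode_def)
qed


section \<open>Recursively enumerable predicates and inductive definitions\<close>

definition re :: "(nat \<Rightarrow> bool) \<Rightarrow> bool" where
  "re Q \<longleftrightarrow> (\<exists>P. prp (\<lambda>e. P (pfst e) (psnd e)) \<and> (\<forall>n. Q n \<longleftrightarrow> (\<exists>t. P t n)))"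

text \<open>Finite subsets of \<open>X\<close> enter as bit codes \<open>s\<close>; \<open>w\<close> is a witness for the remaining existential
  quantifiers.\<close>

definition reop :: "((nat \<Rightarrow> bool) \<Rightarrow> nat \<Rightarrow> bool) \<Rightarrow> bool" where
  "reop \<Phi> \<longleftrightarrow> (\<exists>R. prp (\<lambda>e. R (pfst e) (pfst (psnd e)) (psnd (psnd e))) \<and>
     (\<forall>s s' w n. R s w n \<longrightarrow> set_decode s \<subseteq> set_decode s' \<longrightarrow> R s' w n) \<and>
     (\<forall>X n. \<Phi> X n \<longleftrightarrow> (\<exists>s w. set_decode s \<subseteq> Collect X \<and> R s w n)))"

lemma reopI:
  assumes "prp (\<lambda>e. R (pfst e) (pfst (psnd e)) (psnd (psnd e)))"
    and "\<And>s s' w n. R s w n \<Longrightarrow> set_decode s \<subseteq> set_decode s' \<Longrightarrow> R s' w n"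
    and "\<And>X n. \<Phi> X n \<longleftrightarrow> (\<exists>s w. set_decode s \<subseteq> Collect X \<and> R s w n)"
  shows "reop \<Phi>"
  unfolding reop_def using assms by blast

lemma reopE:
  assumes "reop \<Phi>"
  obtains R where "prp (\<lambda>e. R (pfst e) (pfst (psnd e)) (psnd (psnd e)))"
    and "\<And>s s' w n. R s w n \<Longrightarrow> set_decode s \<subseteq> set_decode s' \<Longrightarrow> R s' w n"
    and "\<And>X n. \<Phi> X n \<longleftrightarrow> (\<exists>s w. set_decode s \<subseteq> Collect X \<and> R s w n)"
  using assms unfolding reop_def by blast

section \<open>Closure properties of recursively enumerable operators\<close>

lemma reop_prp:
  assumes "prp P"
  shows "reop (\<lambda>X n. P n)"
proof (rule reopI[where R = "\<lambda>s w n. P n"])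
  show "P n \<longleftrightarrow> (\<exists>s w. set_decode s \<subseteq> Collect X \<and> P n)" for X n
    \<comment> \<open>The code \<open>0\<close> of the empty set serves as the finite part.\<close>
    using set_decode_zero by blast
qed (intro prp_comp[OF assms] pr_psnd pr_id, blast)

lemmas reop_eq = reop_prp[OF prp_eq]
lemmas reop_less = reop_prp[OF prp_less]
lemmas reop_neq = reop_prp[OF prp_not[OF prp_eq]]

text \<open>This is how a premise of a rule refers to the predicate being defined: the singleton of
  \<open>f n\<close> certifies it.\<close>

lemma reop_rec:
  assumes "pr f"
  shows "reop (\<lambda>X n. X (f n))"
proof (rule reopI[where R = "\<lambda>s w n. f n \<in> set_decode s"])
  show "X (f n) \<longleftrightarrow> (\<exists>s w. set_decode s \<subseteq> Collect X \<and> f n \<in> set_decode s)" for X n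
  proof
    assume "X (f n)"
    then have "set_decode (set_encode {f n}) \<subseteq> Collect X \<and> f n \<in> set_decode (set_encode {f n})"
      by (simp del: set_encode_insert)
    then show "\<exists>s w. set_decode s \<subseteq> Collect X \<and> f n \<in> set_decode s" by blast
  qed blast
qed (intro prp_set_decode pr_comp[OF assms] pr_pfst pr_psnd pr_id, blast)

text \<open>The finite sets used by the two conjuncts are united and the witnesses paired;
  monotonicity in the finite set carries both relations over to the union.\<close>

lemma reop_conj:
  assumes "reop \<Phi>" "reop \<Psi>"
  shows "reop (\<lambda>X n. \<Phi> X n \<and> \<Psi> X n)"
proof -
  obtain R where R: "prp (\<lambda>e. R (pfst e) (pfst (psnd e)) (psnd (psnd e)))"
    "\<And>s s' w n. R s w n \<Longrightarrow> set_decode s \<subseteq> set_decode s' \<Longrightarrow> R s' w n"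
    "\<And>X n. \<Phi> X n \<longleftrightarrow> (\<exists>s w. set_decode s \<subseteq> Collect X \<and> R s w n)"
    using assms(1) by (rule reopE) blast
  obtain S where S: "prp (\<lambda>e. S (pfst e) (pfst (psnd e)) (psnd (psnd e)))"
    "\<And>s s' w n. S s w n \<Longrightarrow> set_decode s \<subseteq> set_decode s' \<Longrightarrow> S s' w n"
    "\<And>X n. \<Psi> X n \<longleftrightarrow> (\<exists>s w. set_decode s \<subseteq> Collect X \<and> S s w n)"
    using assms(2) by (rule reopE) blast
  show ?thesis
  proof (rule reopI[where R = "\<lambda>s w n. R s (pfst w) n \<and> S s (psnd w) n"])
    have "prp (\<lambda>e. R (pfst e) (pfst (pfst (psnd e))) (psnd (psnd e)))"
      using prp_comp[OF R(1), of "\<lambda>e. prod_encode (pfst e, prod_encode (pfst (pfst (psnd e)), psnd (psnd e)))"]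
      by (simp add: pr_prod_encode pr_pfst pr_psnd pr_id)
    moreover have "prp (\<lambda>e. S (pfst e) (psnd (pfst (psnd e))) (psnd (psnd e)))"
      using prp_comp[OF S(1), of "\<lambda>e. prod_encode (pfst e, prod_encode (psnd (pfst (psnd e)), psnd (psnd e)))"]
      by (simp add: pr_prod_encode pr_pfst pr_psnd pr_id)
    ultimately show "prp (\<lambda>e. R (pfst e) (pfst (pfst (psnd e))) (psnd (psnd e)) \<and>
        S (pfst e) (psnd (pfst (psnd e))) (psnd (psnd e)))"
      by (rule prp_conj)
  next
    fix X n
    show "\<Phi> X n \<and> \<Psi> X n \<longleftrightarrow>
      (\<exists>s w. set_decode s \<subseteq> Collect X \<and> R s (pfst w) n \<and> S s (psnd w) n)"
    proof
      assume "\<Phi> X n \<and> \<Psi> X n"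
      then obtain s w s' w' where s: "set_decode s \<subseteq> Collect X" "R s w n"
        "set_decode s' \<subseteq> Collect X" "S s' w' n"
        using R(3) S(3) by blast
      let ?s = "set_encode (set_decode s \<union> set_decode s')"
      have "set_decode ?s = set_decode s \<union> set_decode s'" by simp
      then have "set_decode ?s \<subseteq> Collect X" "R ?s w n" "S ?s w' n"
        using s R(2)[of s w n ?s] S(2)[of s' w' n ?s] by auto
      then show "\<exists>s w. set_decode s \<subseteq> Collect X \<and> R s (pfst w) n \<and> S s (psnd w) n"
        by (intro exI[of _ ?s] exI[of _ "prod_encode (w, w')"]) simp
    next
      assume "\<exists>s w. set_decode s \<subseteq> Collect X \<and> R s (pfst w) n \<and> S s (psnd w) n"
      then show "\<Phi> X n \<and> \<Psi> X n"
        unfolding R(3) S(3) by blast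
    qed
  next
    show "R s' (pfst w) n \<and> S s' (psnd w) n"
      if "R s (pfst w) n \<and> S s (psnd w) n" "set_decode s \<subseteq> set_decode s'" for s s' w n
      using that R(2)[of s "pfst w" n s'] S(2)[of s "psnd w" n s'] by blast
  qed
qed

lemma reop_disj:
  assumes "reop \<Phi>" "reop \<Psi>"
  shows "reop (\<lambda>X n. \<Phi> X n \<or> \<Psi> X n)"
proof -
  obtain R where R: "prp (\<lambda>e. R (pfst e) (pfst (psnd e)) (psnd (psnd e)))"
    "\<And>s s' w n. R s w n \<Longrightarrow> set_decode s \<subseteq> set_decode s' \<Longrightarrow> R s' w n"
    "\<And>X n. \<Phi> X n \<longleftrightarrow> (\<exists>s w. set_decode s \<subseteq> Collect X \<and> R s w n)"
    using assms(1) by (rule reopE) blast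
  obtain S where S: "prp (\<lambda>e. S (pfst e) (pfst (psnd e)) (psnd (psnd e)))"
    "\<And>s s' w n. S s w n \<Longrightarrow> set_decode s \<subseteq> set_decode s' \<Longrightarrow> S s' w n"
    "\<And>X n. \<Psi> X n \<longleftrightarrow> (\<exists>s w. set_decode s \<subseteq> Collect X \<and> S s w n)"
    using assms(2) by (rule reopE) blast
  show ?thesis
  proof (rule reopI[where R = "\<lambda>s w n. R s w n \<or> S s w n"])
    show "prp (\<lambda>e. R (pfst e) (pfst (psnd e)) (psnd (psnd e)) \<or>
        S (pfst e) (pfst (psnd e)) (psnd (psnd e)))"
      using R(1) S(1) by (rule prp_disj)
    show "R s' w n \<or> S s' w n" if "R s w n \<or> S s w n" "set_decode s \<subseteq> set_decode s'" for s s' w n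
      using that R(2)[of s w n s'] S(2)[of s w n s'] by blast
    show "\<Phi> X n \<or> \<Psi> X n \<longleftrightarrow> (\<exists>s w. set_decode s \<subseteq> Collect X \<and> (R s w n \<or> S s w n))" for X n
      unfolding R(3) S(3) by blast
  qed
qed

text \<open>The value of the quantified variable becomes the first component of the witness.\<close>

lemma reop_ex:
  assumes "reop (\<lambda>X e. \<Phi> X (pfst e) (psnd e))"
  shows "reop (\<lambda>X n. \<exists>m. \<Phi> X m n)"
proof -
  obtain R where R: "prp (\<lambda>e. R (pfst e) (pfst (psnd e)) (psnd (psnd e)))"
    "\<And>s s' w n. R s w n \<Longrightarrow> set_decode s \<subseteq> set_decode s' \<Longrightarrow> R s' w n"
    "\<And>X n. \<Phi> X (pfst n) (psnd n) \<longleftrightarrow> (\<exists>s w. set_decode s \<subseteq> Collect X \<and> R s w n)"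
    using assms by (rule reopE) blast
  show ?thesis
  proof (rule reopI[where R = "\<lambda>s w n. R s (psnd w) (prod_encode (pfst w, n))"])
    show "prp (\<lambda>e. R (pfst e) (psnd (pfst (psnd e))) (prod_encode (pfst (pfst (psnd e)), psnd (psnd e))))"
      using prp_comp[OF R(1), of "\<lambda>e. prod_encode (pfst e, prod_encode (psnd (pfst (psnd e)),
          prod_encode (pfst (pfst (psnd e)), psnd (psnd e))))"]
      by (simp add: pr_prod_encode pr_pfst pr_psnd pr_id)
  next
    fix X n
    show "(\<exists>m. \<Phi> X m n) \<longleftrightarrow>
      (\<exists>s w. set_decode s \<subseteq> Collect X \<and> R s (psnd w) (prod_encode (pfst w, n)))"
    proof
      assume "\<exists>m. \<Phi> X m n"
      then obtain m s w where "set_decode s \<subseteq> Collect X" "R s w (prod_encode (m, n))"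
        using R(3)[of X "prod_encode (_, n)"] by auto
      then show "\<exists>s w. set_decode s \<subseteq> Collect X \<and> R s (psnd w) (prod_encode (pfst w, n))"
        by (intro exI[of _ s] exI[of _ "prod_encode (m, w)"]) simp
    next
      assume "\<exists>s w. set_decode s \<subseteq> Collect X \<and> R s (psnd w) (prod_encode (pfst w, n))"
      then obtain s w where "set_decode s \<subseteq> Collect X" "R s (psnd w) (prod_encode (pfst w, n))"
        by blast
      then show "\<exists>m. \<Phi> X m n"
        using R(3)[of X "prod_encode (pfst w, n)"] by auto
    qed
  next
    show "R s' (psnd w) (prod_encode (pfst w, n))"
      if "R s (psnd w) (prod_encode (pfst w, n))" "set_decode s \<subseteq> set_decode s'" for s s' w n
      using that by (rule R(2))
  qed
qed

text \<open>Through this rule an inductive definition can use predicates enumerated earlier as side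
  conditions.\<close>

lemma reop_re:
  assumes "re Q" "pr f"
  shows "reop (\<lambda>X n. Q (f n))"
proof -
  obtain P where P: "prp (\<lambda>e. P (pfst e) (psnd e))" "\<And>n. Q n \<longleftrightarrow> (\<exists>t. P t n)"
    using assms(1) unfolding re_def by blast
  have "reop (\<lambda>X n. \<exists>t. P t (f n))"
    using prp_comp[OF P(1), of "\<lambda>e. prod_encode (pfst e, f (psnd e))"]
    by (intro reop_ex reop_prp)
      (simp add: pr_prod_encode pr_pfst pr_psnd pr_id pr_comp[OF assms(2)])
  with P(2) show ?thesis by simp
qed

text \<open>The least fixed point is enumerated in stages coding finite sets of numbers.  Stage \<open>t + 1\<close>
  tries to add the number \<open>n\<close> with witness \<open>w\<close>, where \<open>t\<close> codes \<open>(n, w, k)\<close> for some \<open>k\<close>; every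
  pair \<open>(n, w)\<close> is thus tried at arbitrarily late stages.\<close>

theorem re_lfp:
  assumes "reop \<Phi>"
  shows "re (lfp \<Phi>)"
proof -
  obtain R where R: "prp (\<lambda>e. R (pfst e) (pfst (psnd e)) (psnd (psnd e)))"
    "\<And>s s' w n. R s w n \<Longrightarrow> set_decode s \<subseteq> set_decode s' \<Longrightarrow> R s' w n"
    "\<And>X n. \<Phi> X n \<longleftrightarrow> (\<exists>s w. set_decode s \<subseteq> Collect X \<and> R s w n)"
    using assms by (rule reopE) blast
  have mono: "mono \<Phi>"
    by (intro monoI predicate1I) (unfold R(3), blast)
  \<comment> \<open>The test that \<open>pfst t\<close> is absent prevents a carry, so adding the
    power of two inserts exactly this element.\<close>
  define step where "step t s =
    (if pfst t \<notin> set_decode s \<and> R s (pfst (psnd t)) (pfst t) then s + 2 ^ pfst t else s)" for t s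
  define D where "D = rec_nat 0 step"
  have D_0: "set_decode (D 0) = {}"
    by (simp add: D_def)
  have D_Suc: "set_decode (D (Suc t)) =
    (if R (D t) (pfst (psnd t)) (pfst t) then insert (pfst t) (set_decode (D t)) else set_decode (D t))" for t
    using set_decode_plus_power_2[of "pfst t" "D t"]
    by (auto simp: D_def step_def add.commute)
  have D_mono: "set_decode (D t) \<subseteq> set_decode (D t')" if "t \<le> t'" for t t'
    using that by (rule lift_Suc_mono_le[rotated]) (auto simp: D_Suc)
  have lfp_iff: "lfp \<Phi> n \<longleftrightarrow> (\<exists>t. n \<in> set_decode (D t))" for n
  proof
    \<comment> \<open>The stages stay inside the least fixed point: a number is added only if
      \<open>R\<close> derives it from the current stage.\<close>
    have "\<forall>n\<in>set_decode (D t). lfp \<Phi> n" for t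
    proof (induction t)
      case (Suc t)
      then have "R (D t) w n \<Longrightarrow> lfp \<Phi> n" for w n
        using R(3)[of "lfp \<Phi>" n] lfp_unfold[OF mono] by (metis mem_Collect_eq subsetI)
      with Suc show ?case by (auto simp: D_Suc split: if_splits)
    qed (simp add: D_0)
    then show "\<exists>t. n \<in> set_decode (D t) \<Longrightarrow> lfp \<Phi> n" by blast
  next
    let ?U = "\<lambda>n. \<exists>t. n \<in> set_decode (D t)"
    have "\<Phi> ?U \<le> ?U"
    proof (intro predicate1I)
      fix n
      assume "\<Phi> ?U n"
      then obtain s w where s: "set_decode s \<subseteq> Collect ?U" "R s w n"
        using R(3) by blast
      \<comment> \<open>A finite subset of the union of an increasing chain lies in a single
        stage.\<close>
      have "\<exists>T. A \<subseteq> set_decode (D T)" if "finite A" "A \<subseteq> Collect ?U" for A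
        using that
      proof (induction A)
        case (insert a A)
        then obtain T t where "A \<subseteq> set_decode (D T)" "a \<in> set_decode (D t)" by blast
        then have "insert a A \<subseteq> set_decode (D (max T t))"
          using D_mono[of T "max T t"] D_mono[of t "max T t"] by auto
        then show ?case by blast
      qed blast
      with s(1) obtain T where T: "set_decode s \<subseteq> set_decode (D T)"
        using finite_set_decode by blast
      \<comment> \<open>With \<open>T\<close> as last component the stage number is at least
        \<open>T\<close>, because a pair code bounds its components.\<close>
      let ?t = "prod_encode (n, prod_encode (w, T))"
      have "T \<le> ?t"
        using le_prod_encode_2[of T w] le_prod_encode_2[of "prod_encode (w, T)" n] by simp
      with T have "set_decode s \<subseteq> set_decode (D ?t)"
        using D_mono by blast
      with s(2) have "R (D ?t) w n"
        using R(2) by blast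
      then have "n \<in> set_decode (D (Suc ?t))"
        by (simp add: D_Suc)
      then show "?U n" by blast
    qed
    then have "lfp \<Phi> \<le> ?U" by (rule lfp_lowerbound)
    then show "lfp \<Phi> n \<Longrightarrow> ?U n" by blast
  qed
  have "prp (\<lambda>e. R (psnd e) (pfst (psnd (pfst e))) (pfst (pfst e)))"
    using prp_comp[OF R(1), of "\<lambda>e. prod_encode (psnd e, prod_encode (pfst (psnd (pfst e)), pfst (pfst e)))"]
    by (simp add: pr_prod_encode pr_pfst pr_psnd pr_id)
  then have "pr (\<lambda>e. step (pfst e) (psnd e))"
    unfolding step_def
    by (intro pr_if prp_conj prp_not prp_set_decode pr_add pr_power_2 pr_pfst pr_psnd pr_id)
  \<comment> \<open>Recursion with a parameter expects a step on coded triples; here the third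
    component is a dummy.\<close>
  from pr_comp[OF this, of "\<lambda>e. prod_encode (pfst e, pfst (psnd e))"]
  have "pr (\<lambda>e. step (pfst e) (pfst (psnd e)))"
    by (simp add: pr_prod_encode pr_pfst pr_psnd pr_id)
  then have "pr (\<lambda>x. rec_nat 0 (\<lambda>y r. step y r) x)"
    by (intro pr_rec_nat[where g = "\<lambda>x. 0" and k = "\<lambda>x. x" and h = "\<lambda>y r x. step y r"] pr_const pr_id)
  then have "pr D" by (simp add: D_def)
  then have "prp (\<lambda>e. psnd e \<in> set_decode (D (pfst e)))"
    by (intro prp_set_decode pr_comp[OF \<open>pr D\<close>] pr_pfst pr_psnd pr_id)
  then show ?thesis
    unfolding re_def lfp_iff by (intro exI[of _ "\<lambda>t n. n \<in> set_decode (D t)"]) simp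
qed


section \<open>Arithmetization of syntax\<close>

text \<open>The constructor of \<open>list_encode\<close> as an operation on numbers, with
  \<open>0\<close> as the empty list. Codes and tuples of codes thereby become patterns that are
  injective and differ from \<open>0\<close>.\<close>

definition pcons :: "nat \<Rightarrow> nat \<Rightarrow> nat"  (infixr "\<triangleright>" 65) where
  "a \<triangleright> l = Suc (prod_encode (a, l))"

lemma pcons_eq [simp]: "a \<triangleright> l = b \<triangleright> m \<longleftrightarrow> a = b \<and> l = m"
  and pcons_neq_0 [simp]: "a \<triangleright> l \<noteq> 0" "0 \<noteq> a \<triangleright> l"
  by (simp_all add: pcons_def)

lemma list_encode_Cons [simp]: "list_encode (x # xs) = x \<triangleright> list_encode xs"
  by (simp add: pcons_def)

declare list_encode.simps(2) [simp del]

lemma pr_pcons: "pr f \<Longrightarrow> pr g \<Longrightarrow> pr (\<lambda>x. f x \<triangleright> g x)"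
  unfolding pcons_def by (intro pr_Suc pr_prod_encode)

text \<open>The operator of an inductive definition is a disjunction over its rules of existentially
  quantified equations and premises, and these are the closure properties that such an operator
  calls for.\<close>

lemmas reop_intros = reop_conj reop_disj reop_ex reop_eq reop_neq reop_less reop_rec
lemmas pr_intros = pr_id pr_const pr_pcons pr_Suc pr_pfst pr_psnd

lemma gn_sym_eq [simp]: "gn_sym f = gn_sym g \<longleftrightarrow> f = g"
  using gn_sym_inj by blast

lemma gn_trm_eq [simp]: "gn_trm s = gn_trm t \<longleftrightarrow> s = t"
  using gn_trm_inj by blast

lemma gn_eq [simp]: "gn A = gn B \<longleftrightarrow> A = B"
  using gn_inj by blast

abbreviation (input) fnC :: "nat \<Rightarrow> nat \<Rightarrow> nat" where "fnC f ts \<equiv> 1 \<triangleright> f \<triangleright> ts"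
abbreviation (input) eqC :: "nat \<Rightarrow> nat \<Rightarrow> nat" where "eqC s t \<equiv> 1 \<triangleright> s \<triangleright> t \<triangleright> 0"
abbreviation (input) impC :: "nat \<Rightarrow> nat \<Rightarrow> nat" where "impC a b \<equiv> 2 \<triangleright> a \<triangleright> b \<triangleright> 0"
abbreviation (input) allC :: "nat \<Rightarrow> nat \<Rightarrow> nat" where "allC x a \<equiv> 3 \<triangleright> x \<triangleright> a \<triangleright> 0"
abbreviation (input) varC :: "nat \<Rightarrow> nat" where "varC x \<equiv> 0 \<triangleright> x \<triangleright> 0"
abbreviation (input) zeroC :: nat where "zeroC \<equiv> fnC (0 \<triangleright> 0) 0"
abbreviation (input) succC :: "nat \<Rightarrow> nat" where "succC t \<equiv> fnC (1 \<triangleright> 0) (t \<triangleright> 0)"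

\<comment> \<open>makes the definitions of inductive predicates as least fixed points available\<close>
declare [[inductive_internals]]

text \<open>Each of the following predicates holds of codes of tuples.  A judgement about expressions and
  the corresponding judgement about lists of expressions are combined into one predicate; they are
  told apart by the length of the tuple.\<close>

inductive symC :: "nat \<Rightarrow> bool" where
  "symC ((0 \<triangleright> 0) \<triangleright> 0 \<triangleright> 0)"
| "symC ((1 \<triangleright> 0) \<triangleright> 1 \<triangleright> 0)"
| "i < n \<Longrightarrow> symC ((2 \<triangleright> n \<triangleright> i \<triangleright> 0) \<triangleright> n \<triangleright> 0)"
| "symC (g \<triangleright> k \<triangleright> 0) \<Longrightarrow> symC (hs \<triangleright> n \<triangleright> k \<triangleright> 0) \<Longrightarrow> symC ((3 \<triangleright> n \<triangleright> g \<triangleright> hs) \<triangleright> n \<triangleright> 0)"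
| "symC (g \<triangleright> k \<triangleright> 0) \<Longrightarrow> symC (h \<triangleright> Suc (Suc k) \<triangleright> 0) \<Longrightarrow> symC ((4 \<triangleright> g \<triangleright> h \<triangleright> 0) \<triangleright> Suc k \<triangleright> 0)"
| "symC (0 \<triangleright> n \<triangleright> 0 \<triangleright> 0)"
| "symC (h \<triangleright> n \<triangleright> 0) \<Longrightarrow> symC (hs \<triangleright> n \<triangleright> k \<triangleright> 0) \<Longrightarrow> symC ((h \<triangleright> hs) \<triangleright> n \<triangleright> Suc k \<triangleright> 0)"

lemma re_symC: "re symC"
  unfolding symC_def by (intro re_lfp reop_intros pr_intros)

inductive trmC :: "nat \<Rightarrow> bool" where
  "trmC (varC x \<triangleright> 0)"
| "symC (f \<triangleright> n \<triangleright> 0) \<Longrightarrow> trmC (ts \<triangleright> n \<triangleright> 0) \<Longrightarrow> trmC (fnC f ts \<triangleright> 0)"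
| "trmC (0 \<triangleright> 0 \<triangleright> 0)"
| "trmC (t \<triangleright> 0) \<Longrightarrow> trmC (ts \<triangleright> n \<triangleright> 0) \<Longrightarrow> trmC ((t \<triangleright> ts) \<triangleright> Suc n \<triangleright> 0)"

lemma re_trmC: "re trmC"
  unfolding trmC_def by (intro re_lfp reop_intros pr_intros reop_re[OF re_symC])

inductive fmC :: "nat \<Rightarrow> bool" where
  "fmC (0 \<triangleright> 0)"
| "trmC (s \<triangleright> 0) \<Longrightarrow> trmC (t \<triangleright> 0) \<Longrightarrow> fmC (eqC s t)"
| "fmC a \<Longrightarrow> fmC b \<Longrightarrow> fmC (impC a b)"
| "fmC a \<Longrightarrow> fmC (allC x a)"

lemma re_fmC: "re fmC"
  unfolding fmC_def by (intro re_lfp reop_intros pr_intros reop_re[OF re_trmC])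

text \<open>The components are variable, inserted term, source and result; a further
  \<open>0\<close> marks the judgement about argument lists. Symbol codes are copied
  unchecked.\<close>

inductive substT :: "nat \<Rightarrow> bool" where
  "substT (x \<triangleright> u \<triangleright> varC x \<triangleright> u \<triangleright> 0)"
| "y \<noteq> x \<Longrightarrow> substT (x \<triangleright> u \<triangleright> varC y \<triangleright> varC y \<triangleright> 0)"
| "substT (x \<triangleright> u \<triangleright> ts \<triangleright> ts' \<triangleright> 0 \<triangleright> 0) \<Longrightarrow> substT (x \<triangleright> u \<triangleright> fnC f ts \<triangleright> fnC f ts' \<triangleright> 0)"
| "substT (x \<triangleright> u \<triangleright> 0 \<triangleright> 0 \<triangleright> 0 \<triangleright> 0)"
| "substT (x \<triangleright> u \<triangleright> t \<triangleright> t' \<triangleright> 0) \<Longrightarrow> substT (x \<triangleright> u \<triangleright> ts \<triangleright> ts' \<triangleright> 0 \<triangleright> 0) \<Longrightarrow>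
    substT (x \<triangleright> u \<triangleright> (t \<triangleright> ts) \<triangleright> (t' \<triangleright> ts') \<triangleright> 0 \<triangleright> 0)"

lemma re_substT: "re substT"
  unfolding substT_def by (intro re_lfp reop_intros pr_intros)

inductive substF :: "nat \<Rightarrow> bool" where
  "substF (x \<triangleright> u \<triangleright> (0 \<triangleright> 0) \<triangleright> (0 \<triangleright> 0) \<triangleright> 0)"
| "substT (x \<triangleright> u \<triangleright> s \<triangleright> s' \<triangleright> 0) \<Longrightarrow> substT (x \<triangleright> u \<triangleright> t \<triangleright> t' \<triangleright> 0) \<Longrightarrow>
    substF (x \<triangleright> u \<triangleright> eqC s t \<triangleright> eqC s' t' \<triangleright> 0)"
| "substF (x \<triangleright> u \<triangleright> a \<triangleright> a' \<triangleright> 0) \<Longrightarrow> substF (x \<triangleright> u \<triangleright> b \<triangleright> b' \<triangleright> 0) \<Longrightarrow>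
    substF (x \<triangleright> u \<triangleright> impC a b \<triangleright> impC a' b' \<triangleright> 0)"
| "substF (x \<triangleright> u \<triangleright> allC x a \<triangleright> allC x a \<triangleright> 0)"
| "y \<noteq> x \<Longrightarrow> substF (x \<triangleright> u \<triangleright> a \<triangleright> a' \<triangleright> 0) \<Longrightarrow> substF (x \<triangleright> u \<triangleright> allC y a \<triangleright> allC y a' \<triangleright> 0)"

lemma re_substF: "re substF"
  unfolding substF_def by (intro re_lfp reop_intros pr_intros reop_re[OF re_substT])

text \<open>A variable is not free in an expression iff substituting \<open>0\<close> for it changes nothing.\<close>

inductive free_forC :: "nat \<Rightarrow> bool" where
  "free_forC (u \<triangleright> x \<triangleright> (0 \<triangleright> 0) \<triangleright> 0)"
| "free_forC (u \<triangleright> x \<triangleright> eqC s t \<triangleright> 0)"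
| "free_forC (u \<triangleright> x \<triangleright> a \<triangleright> 0) \<Longrightarrow> free_forC (u \<triangleright> x \<triangleright> b \<triangleright> 0) \<Longrightarrow> free_forC (u \<triangleright> x \<triangleright> impC a b \<triangleright> 0)"
| "substF (x \<triangleright> zeroC \<triangleright> allC y a \<triangleright> allC y a \<triangleright> 0) \<Longrightarrow> free_forC (u \<triangleright> x \<triangleright> allC y a \<triangleright> 0)"
| "substT (y \<triangleright> zeroC \<triangleright> u \<triangleright> u \<triangleright> 0) \<Longrightarrow> free_forC (u \<triangleright> x \<triangleright> a \<triangleright> 0) \<Longrightarrow>
    free_forC (u \<triangleright> x \<triangleright> allC y a \<triangleright> 0)"

lemma re_free_forC: "re free_forC"
  unfolding free_forC_def
  by (intro re_lfp reop_intros pr_intros reop_re[OF re_substT] reop_re[OF re_substF])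

text \<open>The variables with index from \<open>m\<close> up to, but excluding, \<open>n\<close>:
  the argument lists of the defining equations.\<close>

inductive varsC :: "nat \<Rightarrow> bool" where
  "varsC (n \<triangleright> n \<triangleright> 0 \<triangleright> 0)"
| "varsC (Suc m \<triangleright> n \<triangleright> l \<triangleright> 0) \<Longrightarrow> varsC (m \<triangleright> n \<triangleright> (varC m \<triangleright> l) \<triangleright> 0)"

lemma re_varsC: "re varsC"
  unfolding varsC_def by (intro re_lfp reop_intros pr_intros)

inductive map_fnC :: "nat \<Rightarrow> bool" where
  "map_fnC (0 \<triangleright> l \<triangleright> 0 \<triangleright> 0)"
| "map_fnC (hs \<triangleright> l \<triangleright> r \<triangleright> 0) \<Longrightarrow> map_fnC ((h \<triangleright> hs) \<triangleright> l \<triangleright> (fnC h l \<triangleright> r) \<triangleright> 0)"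

lemma re_map_fnC: "re map_fnC"
  unfolding map_fnC_def by (intro re_lfp reop_intros pr_intros)

text \<open>Axioms of \<open>PA\<close> and rules of the calculus form a single inductive
  definition, hence one least fixed point. In the two recursion equations \<open>n\<close> is the
  arity of the recursive symbol, so the parameters are the variables from \<open>1\<close> below
  \<open>n\<close>.\<close>

inductive provC :: "nat \<Rightarrow> bool" where
  succ_not_zero: "provC (gn (Imp (Eq (Fn Succ [Var 0]) (num 0)) Bot))"
| succ_inj: "provC (gn (Imp (Eq (Fn Succ [Var 0]) (Fn Succ [Var 1])) (Eq (Var 0) (Var 1))))"
| proj_eq: "i < n \<Longrightarrow> varsC (0 \<triangleright> n \<triangleright> l \<triangleright> 0) \<Longrightarrow> provC (eqC (fnC (2 \<triangleright> n \<triangleright> i \<triangleright> 0) l) (varC i))"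
| comp_eq: "symC ((3 \<triangleright> n \<triangleright> g \<triangleright> hs) \<triangleright> n \<triangleright> 0) \<Longrightarrow> varsC (0 \<triangleright> n \<triangleright> l \<triangleright> 0) \<Longrightarrow>
    map_fnC (hs \<triangleright> l \<triangleright> r \<triangleright> 0) \<Longrightarrow> provC (eqC (fnC (3 \<triangleright> n \<triangleright> g \<triangleright> hs) l) (fnC g r))"
| rec_zero: "symC ((4 \<triangleright> g \<triangleright> h \<triangleright> 0) \<triangleright> n \<triangleright> 0) \<Longrightarrow> varsC (1 \<triangleright> n \<triangleright> l \<triangleright> 0) \<Longrightarrow>
    provC (eqC (fnC (4 \<triangleright> g \<triangleright> h \<triangleright> 0) (zeroC \<triangleright> l)) (fnC g l))"
| rec_succ: "symC ((4 \<triangleright> g \<triangleright> h \<triangleright> 0) \<triangleright> n \<triangleright> 0) \<Longrightarrow> varsC (1 \<triangleright> n \<triangleright> l \<triangleright> 0) \<Longrightarrow>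
    provC (eqC (fnC (4 \<triangleright> g \<triangleright> h \<triangleright> 0) (succC (varC 0) \<triangleright> l))
      (fnC h (varC 0 \<triangleright> fnC (4 \<triangleright> g \<triangleright> h \<triangleright> 0) (varC 0 \<triangleright> l) \<triangleright> l)))"
| induction: "fmC a \<Longrightarrow> substF (x \<triangleright> zeroC \<triangleright> a \<triangleright> b \<triangleright> 0) \<Longrightarrow>
    substF (x \<triangleright> succC (varC x) \<triangleright> a \<triangleright> c \<triangleright> 0) \<Longrightarrow>
    provC (impC b (impC (allC x (impC a c)) (allC x a)))"
| K: "fmC a \<Longrightarrow> fmC b \<Longrightarrow> provC (impC a (impC b a))"
| S: "fmC a \<Longrightarrow> fmC b \<Longrightarrow> fmC c \<Longrightarrow>
    provC (impC (impC a (impC b c)) (impC (impC a b) (impC a c)))"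
| DN: "fmC a \<Longrightarrow> provC (impC (impC (impC a (0 \<triangleright> 0)) (0 \<triangleright> 0)) a)"
| AllE: "fmC a \<Longrightarrow> trmC (t \<triangleright> 0) \<Longrightarrow> free_forC (t \<triangleright> x \<triangleright> a \<triangleright> 0) \<Longrightarrow>
    substF (x \<triangleright> t \<triangleright> a \<triangleright> b \<triangleright> 0) \<Longrightarrow> provC (impC (allC x a) b)"
| AllD: "fmC a \<Longrightarrow> fmC b \<Longrightarrow> substF (x \<triangleright> zeroC \<triangleright> a \<triangleright> a \<triangleright> 0) \<Longrightarrow>
    provC (impC (allC x (impC a b)) (impC a (allC x b)))"
| Refl: "trmC (t \<triangleright> 0) \<Longrightarrow> provC (eqC t t)"
| Leibniz: "fmC a \<Longrightarrow> trmC (s \<triangleright> 0) \<Longrightarrow> trmC (t \<triangleright> 0) \<Longrightarrow>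
    free_forC (s \<triangleright> x \<triangleright> a \<triangleright> 0) \<Longrightarrow> free_forC (t \<triangleright> x \<triangleright> a \<triangleright> 0) \<Longrightarrow>
    substF (x \<triangleright> s \<triangleright> a \<triangleright> b \<triangleright> 0) \<Longrightarrow> substF (x \<triangleright> t \<triangleright> a \<triangleright> c \<triangleright> 0) \<Longrightarrow>
    provC (impC (eqC s t) (impC b c))"
| MP: "provC (impC a b) \<Longrightarrow> provC a \<Longrightarrow> provC b"
| Gen: "provC a \<Longrightarrow> provC (allC x a)"

lemma re_provC: "re provC"
  unfolding provC_def
  by (intro re_lfp reop_intros pr_intros reop_re[OF re_symC] reop_re[OF re_trmC] reop_re[OF re_fmC]
      reop_re[OF re_substF] reop_re[OF re_free_forC] reop_re[OF re_varsC] reop_re[OF re_map_fnC])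

section \<open>Adequacy of the coded syntax\<close>

text \<open>The rules pass between symbols and lists of symbols, so both clauses go through one
  induction; each is vacuous for tuples of the other length.\<close>

lemma symC_sound:
  assumes "symC x"
  shows "(\<forall>f n. x = f \<triangleright> n \<triangleright> 0 \<longrightarrow> (\<exists>F. f = gn_sym F \<and> wf_sym F \<and> ar F = n)) \<and>
    (\<forall>hs n k. x = hs \<triangleright> n \<triangleright> k \<triangleright> 0 \<longrightarrow>
      (\<exists>Hs. hs = list_encode (map gn_sym Hs) \<and> length Hs = k \<and> (\<forall>h\<in>set Hs. wf_sym h \<and> ar h = n)))"
  using assms
proof induction
  case 1
  then show ?case by (auto intro: exI[of _ Zero])
next
  case 2
  then show ?case by (auto intro: exI[of _ Succ])
next
  case (3 i n)
  then show ?case by (auto intro: exI[of _ "Proj n i"])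
next
  case (4 g k hs n)
  then obtain G Hs where "g = gn_sym G" "wf_sym G" "ar G = k" "hs = list_encode (map gn_sym Hs)"
    "length Hs = k" "\<forall>h\<in>set Hs. wf_sym h \<and> ar h = n"
    by auto
  then show ?case by (auto intro: exI[of _ "Comp n G Hs"])
next
  case (5 g k h)
  then obtain G H where "g = gn_sym G" "wf_sym G" "ar G = k" "h = gn_sym H" "wf_sym H" "ar H = Suc (Suc k)"
    by auto
  then show ?case by (auto intro: exI[of _ "Rec G H"])
next
  case (7 h n hs k)
  then obtain H Hs where "h = gn_sym H" "wf_sym H" "ar H = n" "hs = list_encode (map gn_sym Hs)"
    "length Hs = k" "\<forall>h\<in>set Hs. wf_sym h \<and> ar h = n"
    by auto
  then show ?case by (auto intro!: exI[of _ "H # Hs"])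
qed auto

lemma symC_complete: "wf_sym f \<Longrightarrow> symC (gn_sym f \<triangleright> ar f \<triangleright> 0)"
proof (induction f)
  case (Comp n g hs)
  \<comment> \<open>Lists over the elements of \<open>hs\<close> permit an induction on the list
    while the hypotheses for its members stay available.\<close>
  have "symC (list_encode (map gn_sym hs') \<triangleright> n \<triangleright> length hs' \<triangleright> 0)" if "set hs' \<subseteq> set hs" for hs'
    using that
  proof (induction hs')
    case Nil
    then show ?case by (simp add: symC.intros)
  next
    case (Cons h hs')
    then have "symC (gn_sym h \<triangleright> n \<triangleright> 0)" using Comp by auto
    with Cons show ?case by (simp add: symC.intros)
  qed
  with Comp show ?case by (auto intro: symC.intros)
qed (use symC.intros in auto)

lemma symC_iff: "symC (f \<triangleright> n \<triangleright> 0) \<longleftrightarrow> (\<exists>F. f = gn_sym F \<and> wf_sym F \<and> ar F = n)"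
  using symC_sound symC_complete by blast

lemma trmC_sound:
  assumes "trmC x"
  shows "(\<forall>t. x = t \<triangleright> 0 \<longrightarrow> (\<exists>s. t = gn_trm s \<and> wf_trm s)) \<and>
    (\<forall>ts n. x = ts \<triangleright> n \<triangleright> 0 \<longrightarrow>
      (\<exists>ss. ts = list_encode (map gn_trm ss) \<and> length ss = n \<and> (\<forall>s\<in>set ss. wf_trm s)))"
  using assms
proof induction
  case (1 x)
  then show ?case by (auto intro: exI[of _ "Var x"])
next
  case (2 f n ts)
  then obtain F ss where "f = gn_sym F" "wf_sym F" "ar F = n" "ts = list_encode (map gn_trm ss)"
    "length ss = n" "\<forall>s\<in>set ss. wf_trm s"
    unfolding symC_iff by auto
  then show ?case by (auto intro: exI[of _ "Fn F ss"])
next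
  case (4 t ts n)
  then obtain s ss where "t = gn_trm s" "wf_trm s" "ts = list_encode (map gn_trm ss)"
    "length ss = n" "\<forall>s\<in>set ss. wf_trm s"
    by auto
  then show ?case by (auto intro!: exI[of _ "s # ss"])
qed auto

lemma trmC_complete: "wf_trm t \<Longrightarrow> trmC (gn_trm t \<triangleright> 0)"
proof (induction t)
  case (Fn f ts)
  have "trmC (list_encode (map gn_trm ts') \<triangleright> length ts' \<triangleright> 0)" if "set ts' \<subseteq> set ts" for ts'
    using that
  proof (induction ts')
    case Nil
    then show ?case by (simp add: trmC.intros)
  next
    case (Cons t ts')
    then have "trmC (gn_trm t \<triangleright> 0)" using Fn by auto
    with Cons show ?case by (simp add: trmC.intros)
  qed
  from this[of ts] Fn.prems trmC.intros(2)[OF symC_complete[of f], of "list_encode (map gn_trm ts)"]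
  show ?case by simp
qed (use trmC.intros in auto)

lemma trmC_iff: "trmC (t \<triangleright> 0) \<longleftrightarrow> (\<exists>s. t = gn_trm s \<and> wf_trm s)"
  using trmC_sound trmC_complete by blast

lemma fmC_iff: "fmC a \<longleftrightarrow> (\<exists>A. a = gn A \<and> wf_fm A)"
proof
  show "fmC a \<Longrightarrow> \<exists>A. a = gn A \<and> wf_fm A"
  proof (induction rule: fmC.induct)
    case 1
    show ?case by (rule exI[of _ Bot]) simp
  next
    case (2 s t)
    then obtain s' t' where "s = gn_trm s'" "wf_trm s'" "t = gn_trm t'" "wf_trm t'"
      unfolding trmC_iff by blast
    then show ?case by (intro exI[of _ "Eq s' t'"]) simp
  next
    case (3 a b)
    then obtain A B where "a = gn A" "wf_fm A" "b = gn B" "wf_fm B" by blast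
    then show ?case by (intro exI[of _ "Imp A B"]) simp
  next
    case (4 a x)
    then obtain A where "a = gn A" "wf_fm A" by blast
    then show ?case by (intro exI[of _ "All x A"]) simp
  qed
  have "wf_fm A \<Longrightarrow> fmC (gn A)" for A
    by (induction A) (use fmC.intros trmC_complete in auto)
  then show "\<exists>A. a = gn A \<and> wf_fm A \<Longrightarrow> fmC a" by blast
qed

text \<open>The code of the input selects the applicable rule, so one inversion per constructor
  computes the result. As \<open>t'\<close> is an arbitrary number, existence and uniqueness of the
  result follow together.\<close>

lemma substT_iff: "substT (x \<triangleright> gn_trm u \<triangleright> gn_trm t \<triangleright> t' \<triangleright> 0) \<longleftrightarrow> t' = gn_trm (subst_trm x u t)"
proof (induction t arbitrary: t')
  case (Var y)
  show ?case by (subst substT.simps) auto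
next
  case (Fn f ts)
  have "substT (x \<triangleright> gn_trm u \<triangleright> list_encode (map gn_trm ss) \<triangleright> ss' \<triangleright> 0 \<triangleright> 0) \<longleftrightarrow>
      ss' = list_encode (map gn_trm (map (subst_trm x u) ss))" if "set ss \<subseteq> set ts" for ss ss'
    using that
  proof (induction ss arbitrary: ss')
    case Nil
    show ?case by (subst substT.simps) auto
  next
    case (Cons s ss)
    then show ?case by (subst substT.simps) (auto simp: Fn)
  qed
  from this[of ts] show ?case by (subst substT.simps) auto
qed

lemma substF_iff: "substF (x \<triangleright> gn_trm u \<triangleright> gn A \<triangleright> b \<triangleright> 0) \<longleftrightarrow> b = gn (subst x u A)"
proof (induction A arbitrary: b)
  case Bot
  show ?case by (subst substF.simps) auto
next
  case (Eq s t)
  show ?case by (subst substF.simps) (auto simp: substT_iff)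
next
  case (Imp A B)
  then show ?case by (subst substF.simps) auto
next
  case (All y A)
  then show ?case by (subst substF.simps) auto
qed

lemma subst_trm_fresh: "x \<notin> fv_trm t \<Longrightarrow> subst_trm x u t = t"
  by (induction t) (auto intro: map_idI)

lemma subst_fresh: "x \<notin> fv A \<Longrightarrow> subst x u A = A"
  by (induction A) (auto simp: subst_trm_fresh)

text \<open>The term \<open>num 0\<close> is not a variable, so replacing an actual occurrence of
  \<open>x\<close> by it alters the term.\<close>

lemma subst_trm_num_0_eq: "subst_trm x (num 0) t = t \<longleftrightarrow> x \<notin> fv_trm t"
  by (induction t) (auto simp: map_idI map_eq_conv[of _ _ "\<lambda>x. x", simplified])

lemma subst_num_0_eq: "subst x (num 0) A = A \<longleftrightarrow> x \<notin> fv A"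
  by (induction A) (auto simp: subst_trm_num_0_eq simp del: num.simps)

lemma zeroC_eq: "zeroC = gn_trm (num 0)"
  by simp

lemma free_forC_iff: "free_forC (gn_trm u \<triangleright> x \<triangleright> gn A \<triangleright> 0) \<longleftrightarrow> free_for u x A"
proof (induction A)
  case (All y A)
  \<comment> \<open>The two freshness tests match the two disjuncts of \<open>free_for\<close> at a
    quantifier.\<close>
  have "substF (x \<triangleright> gn_trm (num 0) \<triangleright> gn (All y A) \<triangleright> gn (All y A) \<triangleright> 0) \<longleftrightarrow> x \<notin> fv (All y A)"
    unfolding substF_iff gn_eq subst_num_0_eq[symmetric] by metis
  moreover have "substT (y \<triangleright> gn_trm (num 0) \<triangleright> gn_trm u \<triangleright> gn_trm u \<triangleright> 0) \<longleftrightarrow> y \<notin> fv_trm u"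
    unfolding substT_iff gn_trm_eq subst_trm_num_0_eq[symmetric] by metis
  ultimately show ?case
    by (subst free_forC.simps) (auto simp: All)
next
  case (Imp A B)
  then show ?case by (subst free_forC.simps) auto
qed (subst free_forC.simps, simp)+

lemma varsC_iff:
  "varsC (m \<triangleright> n \<triangleright> l \<triangleright> 0) \<longleftrightarrow> m \<le> n \<and> l = list_encode (map gn_trm (map Var [m..<n]))"
proof
  have "varsC x \<Longrightarrow> x = m \<triangleright> n \<triangleright> l \<triangleright> 0 \<Longrightarrow>
      m \<le> n \<and> l = list_encode (map gn_trm (map Var [m..<n]))" for x m l
    by (induction x arbitrary: m l rule: varsC.induct) (auto simp: upt_rec[of _ n])
  then show "varsC (m \<triangleright> n \<triangleright> l \<triangleright> 0) \<Longrightarrow>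
      m \<le> n \<and> l = list_encode (map gn_trm (map Var [m..<n]))" by blast
  have "m \<le> n \<Longrightarrow> varsC (m \<triangleright> n \<triangleright> list_encode (map gn_trm (map Var [m..<n])) \<triangleright> 0)"
  proof (induction rule: inc_induct)
    case (step m)
    then show ?case by (simp add: upt_conv_Cons varsC.intros(2))
  qed (simp add: varsC.intros)
  then show "m \<le> n \<and> l = list_encode (map gn_trm (map Var [m..<n])) \<Longrightarrow> varsC (m \<triangleright> n \<triangleright> l \<triangleright> 0)"
    by blast
qed

lemma map_fnC_iff:
  "map_fnC (list_encode (map gn_sym hs) \<triangleright> list_encode (map gn_trm ts) \<triangleright> r \<triangleright> 0) \<longleftrightarrow>
    r = list_encode (map gn_trm (map (\<lambda>h. Fn h ts) hs))"
proof (induction hs arbitrary: r)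
  case Nil
  show ?case by (subst map_fnC.simps) auto
next
  case (Cons h hs)
  then show ?case by (subst map_fnC.simps) auto
qed

lemma free_for_succ: "free_for (Fn Succ [Var x]) x A"
  by (induction A) auto

section \<open>Adequacy of the coded provability predicate\<close>

lemma provC_sound: "provC n \<Longrightarrow> \<exists>A. n = gn A \<and> PA \<turnstile> A"
proof (induction rule: provC.induct)
  case succ_not_zero
  show ?case using provable.Ax[OF PA.succ_not_zero] by blast
next
  case succ_inj
  show ?case using provable.Ax[OF PA.succ_inj] by blast
next
  case (proj_eq i n l)
  then have "PA \<turnstile> Eq (Fn (Proj n i) (map Var [0..<n])) (Var i)"
    by (intro provable.Ax PA.proj_eq) simp
  moreover have "l = list_encode (map gn_trm (map Var [0..<n]))"
    using proj_eq by (simp only: varsC_iff)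
  ultimately show ?case by force
next
  case (comp_eq n g hs l r)
  then obtain F where F: "gn_sym F = 3 \<triangleright> n \<triangleright> g \<triangleright> hs" "wf_sym F"
    by (metis symC_iff)
  \<comment> \<open>The tag \<open>3\<close> leaves only a composite symbol.\<close>
  then obtain G Hs where G: "F = Comp n G Hs" "g = gn_sym G" "hs = list_encode (map gn_sym Hs)"
    by (cases F) auto
  with F have "PA \<turnstile> Eq (Fn F (map Var [0..<n])) (Fn G (map (\<lambda>h. Fn h (map Var [0..<n])) Hs))"
    by (auto intro!: provable.Ax PA.comp_eq)
  moreover have "l = list_encode (map gn_trm (map Var [0..<n]))"
    using comp_eq by (simp only: varsC_iff)
  moreover from this have "r = list_encode (map gn_trm (map (\<lambda>h. Fn h (map Var [0..<n])) Hs))"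
    using comp_eq G by (simp only: map_fnC_iff)
  ultimately show ?case using G by force
next
  case (rec_zero g h n l)
  then obtain F where F: "gn_sym F = 4 \<triangleright> g \<triangleright> h \<triangleright> 0" "wf_sym F" "ar F = n"
    by (metis symC_iff)
  then obtain G H where G: "F = Rec G H" "g = gn_sym G" "h = gn_sym H"
    by (cases F) auto
  let ?xs = "map Var [1..<Suc (ar G)]"
  have "PA \<turnstile> Eq (Fn F (num 0 # ?xs)) (Fn G ?xs)"
    unfolding G(1) using F G by (intro provable.Ax PA.rec_zero refl) simp
  moreover have "l = list_encode (map gn_trm ?xs)"
    using rec_zero F G by (auto simp: varsC_iff simp del: upt_Suc)
  ultimately show ?case using F G by (force simp del: upt_Suc)
next
  case (rec_succ g h n l)
  then obtain F where F: "gn_sym F = 4 \<triangleright> g \<triangleright> h \<triangleright> 0" "wf_sym F" "ar F = n"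
    by (metis symC_iff)
  then obtain G H where G: "F = Rec G H" "g = gn_sym G" "h = gn_sym H"
    by (cases F) auto
  let ?xs = "map Var [1..<Suc (ar G)]"
  have "PA \<turnstile> Eq (Fn F (Fn Succ [Var 0] # ?xs)) (Fn H (Var 0 # Fn F (Var 0 # ?xs) # ?xs))"
    unfolding G(1) using F G by (intro provable.Ax PA.rec_succ refl) simp
  moreover have "l = list_encode (map gn_trm ?xs)"
    using rec_succ F G by (auto simp: varsC_iff simp del: upt_Suc)
  ultimately show ?case using F G by (force simp del: upt_Suc)
next
  case (induction a x b c)
  then obtain A where A: "a = gn A" "wf_fm A" by (auto simp: fmC_iff)
  have "b = gn (subst x (num 0) A)" "c = gn (subst x (Fn Succ [Var x]) A)"
    using induction substF_iff[of x "num 0" A b] substF_iff[of x "Fn Succ [Var x]" A c]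
    by (simp_all add: A)
  with A provable.Ax[OF PA.induction[OF A(2), of x]] show ?case
    by (intro exI[of _ "Imp (subst x (num 0) A)
        (Imp (All x (Imp A (subst x (Fn Succ [Var x]) A))) (All x A))"]) simp
next
  case (K a b)
  then obtain A B where "a = gn A" "wf_fm A" "b = gn B" "wf_fm B" by (auto simp: fmC_iff)
  with provable.K[of A B PA] show ?case by (intro exI[of _ "Imp A (Imp B A)"]) simp
next
  case (S a b c)
  then obtain A B C where "a = gn A" "wf_fm A" "b = gn B" "wf_fm B" "c = gn C" "wf_fm C"
    by (auto simp: fmC_iff)
  with provable.S[of A B C PA] show ?case
    by (intro exI[of _ "Imp (Imp A (Imp B C)) (Imp (Imp A B) (Imp A C))"]) simp
next
  case (DN a)
  then obtain A where "a = gn A" "wf_fm A" by (auto simp: fmC_iff)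
  with provable.DN[of A PA] show ?case
    by (intro exI[of _ "Imp (Imp (Imp A Bot) Bot) A"]) simp
next
  case (AllE a t x b)
  then obtain A u where A: "a = gn A" "wf_fm A" "t = gn_trm u" "wf_trm u"
    by (auto simp: fmC_iff trmC_iff)
  with AllE have "free_for u x A" "b = gn (subst x u A)"
    by (simp_all add: free_forC_iff substF_iff)
  with A provable.AllE[of A u x PA] show ?case
    by (intro exI[of _ "Imp (All x A) (subst x u A)"]) simp
next
  case (AllD a b x)
  then obtain A B where A: "a = gn A" "wf_fm A" "b = gn B" "wf_fm B" by (auto simp: fmC_iff)
  with AllD have "gn A = gn (subst x (num 0) A)"
    unfolding zeroC_eq by (simp only: substF_iff)
  then have "x \<notin> fv A" by (metis gn_eq subst_num_0_eq)
  with A provable.AllD[of A B x PA] show ?case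
    by (intro exI[of _ "Imp (All x (Imp A B)) (Imp A (All x B))"]) simp
next
  case (Refl t)
  then obtain u where "t = gn_trm u" "wf_trm u" by (auto simp: trmC_iff)
  with provable.Refl[of u PA] show ?case by (intro exI[of _ "Eq u u"]) simp
next
  case (Leibniz a s t x b c)
  then obtain A s' t' where A: "a = gn A" "wf_fm A" "s = gn_trm s'" "wf_trm s'" "t = gn_trm t'" "wf_trm t'"
    by (auto simp: fmC_iff trmC_iff)
  with Leibniz have "free_for s' x A" "free_for t' x A" "b = gn (subst x s' A)" "c = gn (subst x t' A)"
    by (simp_all add: free_forC_iff substF_iff)
  with A provable.Leibniz[of A s' t' x PA] show ?case
    by (intro exI[of _ "Imp (Eq s' t') (Imp (subst x s' A) (subst x t' A))"]) simp
next
  case (MP a b)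
  then obtain A C where A: "a = gn A" "PA \<turnstile> A" "gn C = impC a b" "PA \<turnstile> C" by metis
  \<comment> \<open>The tag \<open>2\<close> forces the formula coded by the major premise to be an
    implication; injectivity of \<open>gn\<close> identifies its antecedent with
    \<open>A\<close>.\<close>
  from A(3) obtain A' B where "C = Imp A' B" "gn A' = a" "gn B = b"
    by (cases C) auto
  with A show ?case using provable.MP by (metis gn_eq)
next
  case (Gen a x)
  then obtain A where "a = gn A" "PA \<turnstile> A" by blast
  with provable.Gen show ?case by (intro exI[of _ "All x A"]) simp
qed

lemma provC_PA:
  assumes "A \<in> PA"
  shows "provC (gn A)"
  using assms
proof cases
  case succ_not_zero
  then show ?thesis using provC.succ_not_zero by simp
next
  case succ_inj
  then show ?thesis using provC.succ_inj by simp
next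
  case (proj_eq n i)
  then show ?thesis using provC.proj_eq[of i n] by (simp add: varsC_iff)
next
  case (comp_eq n g hs)
  let ?xs = "map Var [0..<n]"
  have "symC (gn_sym (Comp n g hs) \<triangleright> n \<triangleright> 0)"
    using symC_complete[OF comp_eq(2)] by simp
  then show ?thesis
    using provC.comp_eq[of n "gn_sym g" "list_encode (map gn_sym hs)" "list_encode (map gn_trm ?xs)"
        "list_encode (map gn_trm (map (\<lambda>h. Fn h ?xs) hs))"] comp_eq(1)
    unfolding map_fnC_iff varsC_iff by simp
next
  case (rec_zero g h xs)
  have "symC (gn_sym (Rec g h) \<triangleright> Suc (ar g) \<triangleright> 0)"
    using symC_complete[OF rec_zero(2)] by simp
  then show ?thesis
    using provC.rec_zero[of "gn_sym g" "gn_sym h" "Suc (ar g)" "list_encode (map gn_trm xs)"] rec_zero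
    unfolding varsC_iff by (simp del: upt_Suc)
next
  case (rec_succ g h xs)
  have "symC (gn_sym (Rec g h) \<triangleright> Suc (ar g) \<triangleright> 0)"
    using symC_complete[OF rec_succ(2)] by simp
  then show ?thesis
    using provC.rec_succ[of "gn_sym g" "gn_sym h" "Suc (ar g)" "list_encode (map gn_trm xs)"] rec_succ
    unfolding varsC_iff by (simp del: upt_Suc)
next
  case (induction B x)
  have "fmC (gn B)" using induction fmC_iff by blast
  with provC.induction[of "gn B" x "gn (subst x (num 0) B)" "gn (subst x (Fn Succ [Var x]) B)"]
    substF_iff[of x "num 0" B] substF_iff[of x "Fn Succ [Var x]" B] induction(1)
  show ?thesis by simp
qed

lemma provC_complete: "PA \<turnstile> A \<Longrightarrow> provC (gn A)"
proof (induction rule: provable.induct)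
  case (Ax A)
  then show ?case by (rule provC_PA)
next
  case (K A B)
  then show ?case using provC.K[of "gn A" "gn B"] by (auto simp: fmC_iff)
next
  case (S A B C)
  then show ?case using provC.S[of "gn A" "gn B" "gn C"] by (auto simp: fmC_iff)
next
  case (DN A)
  then show ?case using provC.DN[of "gn A"] by (auto simp: fmC_iff)
next
  case (AllE A t x)
  then show ?case
    using provC.AllE[of "gn A" "gn_trm t" x "gn (subst x t A)"]
    by (auto simp: fmC_iff trmC_iff free_forC_iff substF_iff)
next
  case (AllD A B x)
  then have "substF (x \<triangleright> zeroC \<triangleright> gn A \<triangleright> gn A \<triangleright> 0)"
    unfolding zeroC_eq substF_iff by (simp add: subst_fresh)
  with AllD show ?case using provC.AllD[of "gn A" "gn B" x] by (auto simp: fmC_iff)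
next
  case (Refl t)
  then show ?case using provC.Refl[of "gn_trm t"] by (auto simp: trmC_iff)
next
  case (Leibniz A s t x)
  then show ?case
    using provC.Leibniz[of "gn A" "gn_trm s" "gn_trm t" x "gn (subst x s A)" "gn (subst x t A)"]
    by (auto simp: fmC_iff trmC_iff free_forC_iff substF_iff)
next
  case (MP A B)
  then show ?case using provC.MP[of "gn A" "gn B"] by simp
next
  case (Gen A x)
  then show ?case using provC.Gen[of "gn A" x] by simp
qed

lemma provC_iff: "provC (gn A) \<longleftrightarrow> PA \<turnstile> A"
  using provC_sound provC_complete by fastforce


section \<open>Soundness in the standard model\<close>

fun eval_trm :: "(nat \<Rightarrow> nat) \<Rightarrow> trm \<Rightarrow> nat" where
  "eval_trm e (Var x) = e x"
| "eval_trm e (Fn f ts) = pr_eval f (map (eval_trm e) ts)"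

fun sat :: "(nat \<Rightarrow> nat) \<Rightarrow> fm \<Rightarrow> bool" where
  "sat e Bot \<longleftrightarrow> False"
| "sat e (Eq s t) \<longleftrightarrow> eval_trm e s = eval_trm e t"
| "sat e (Imp A B) \<longleftrightarrow> (sat e A \<longrightarrow> sat e B)"
| "sat e (All x A) \<longleftrightarrow> (\<forall>n. sat (e(x := n)) A)"

lemma eval_trm_cong: "(\<And>x. x \<in> fv_trm t \<Longrightarrow> e x = e' x) \<Longrightarrow> eval_trm e t = eval_trm e' t"
proof (induction t)
  case (Fn f ts)
  then have "map (eval_trm e) ts = map (eval_trm e') ts" by auto
  then show ?case by (simp only: eval_trm.simps)
qed simp

lemma sat_cong: "(\<And>x. x \<in> fv A \<Longrightarrow> e x = e' x) \<Longrightarrow> sat e A \<longleftrightarrow> sat e' A"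
proof (induction A arbitrary: e e')
  case (Eq s t)
  then have "eval_trm e s = eval_trm e' s" "eval_trm e t = eval_trm e' t"
    by (auto intro!: eval_trm_cong)
  then show ?case by simp
next
  case (Imp A B)
  have "sat e A \<longleftrightarrow> sat e' A" "sat e B \<longleftrightarrow> sat e' B"
    by (intro Imp.IH, simp add: Imp.prems)+
  then show ?case by simp
next
  case (All x A)
  have "sat (e(x := n)) A \<longleftrightarrow> sat (e'(x := n)) A" for n
    by (intro All.IH) (simp add: All.prems)
  then show ?case by simp
qed simp

lemma eval_subst_trm: "eval_trm e (subst_trm x u t) = eval_trm (e(x := eval_trm e u)) t"
proof (induction t)
  case (Fn f ts)
  then have "map (eval_trm e \<circ> subst_trm x u) ts = map (eval_trm (e(x := eval_trm e u))) ts"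
    by (simp add: fun_upd_def)
  then show ?case by (simp only: subst_trm.simps eval_trm.simps map_map)
qed simp

lemma sat_subst: "free_for u x A \<Longrightarrow> sat e (subst x u A) \<longleftrightarrow> sat (e(x := eval_trm e u)) A"
proof (induction A arbitrary: e)
  case (All y A)
  show ?case
  proof (cases "x \<in> fv (All y A)")
    case True
    then have "y \<noteq> x" "y \<notin> fv_trm u" "free_for u x A" using All.prems by auto
    \<comment> \<open>No variable of \<open>u\<close> is captured, so its value survives the
      reassignment of \<open>y\<close>.\<close>
    then have "eval_trm (e(y := n)) u = eval_trm e u" for n
      by (intro eval_trm_cong) auto
    with \<open>free_for u x A\<close> have
      "sat (e(y := n)) (subst x u A) \<longleftrightarrow> sat (e(x := eval_trm e u, y := n)) A" for n
      by (simp only: All.IH fun_upd_twist[OF \<open>y \<noteq> x\<close>])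
    with \<open>y \<noteq> x\<close> show ?thesis
      by (simp only: subst.simps sat.simps if_False)
  next
    case False
    then have "sat (e(x := eval_trm e u)) (All y A) \<longleftrightarrow> sat e (All y A)"
      by (intro sat_cong) auto
    with subst_fresh[OF False] show ?thesis by (simp only:)
  qed
qed (auto simp: eval_subst_trm)

lemma free_for_num: "free_for (num n) x A"
proof -
  have "fv_trm (num n) = {}" by (induction n) auto
  then show ?thesis by (induction A) auto
qed

lemma sat_PA: "A \<in> PA \<Longrightarrow> sat e A"
proof (induction rule: PA.induct)
  case (induction A x)
  \<comment> \<open>The induction axiom holds because the quantifiers of the standard model range
    over the natural numbers of the metatheory.\<close>
  have "(\<forall>n. sat (e(x := n)) A \<longrightarrow> sat (e(x := Suc n)) A) \<Longrightarrow> sat (e(x := 0)) A \<Longrightarrow> sat (e(x := n)) A" for n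
    by (induction n) auto
  moreover have "sat e (subst x (num 0) A) \<longleftrightarrow> sat (e(x := 0)) A"
    by (subst sat_subst[OF free_for_num]) simp
  moreover have "sat (e(x := n)) (subst x (Fn Succ [Var x]) A) \<longleftrightarrow> sat (e(x := Suc n)) A" for n
    by (subst sat_subst[OF free_for_succ]) simp
  ultimately show ?case
    unfolding sat.simps by blast
next
  case (proj_eq n i)
  then show ?case by (simp add: comp_def)
next
  case (comp_eq n g hs)
  show ?case by (simp add: comp_def)
next
  case (rec_zero g h xs)
  show ?case by simp
next
  case (rec_succ g h xs)
  show ?case by simp
qed simp_all

text \<open>Validity is shown for all assignments at once, as generalization demands. It yields
  consistency and extracts a witness from a provable existential statement.\<close>

theorem PA_sound: "PA \<turnstile> A \<Longrightarrow> sat e A"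
proof (induction arbitrary: e rule: provable.induct)
  case (AllD A B x)
  then have "sat (e(x := n)) A \<longleftrightarrow> sat e A" for n
    by (intro sat_cong) auto
  then show ?case by simp
next
  case (AllE A t x)
  show ?case unfolding sat.simps sat_subst[OF AllE(3)] by blast
next
  case (Leibniz A s t x)
  show ?case unfolding sat.simps sat_subst[OF Leibniz(4)] sat_subst[OF Leibniz(5)] by simp
next
  case (Gen A x)
  then show ?case unfolding sat.simps by blast
next
  case (MP A B)
  then show ?case unfolding sat.simps by blast
qed (simp_all add: sat_PA)


section \<open>Representability of the function symbols in \<open>PA\<close>\<close>

definition closed_trm :: "trm \<Rightarrow> bool" where
  "closed_trm t \<longleftrightarrow> wf_trm t \<and> fv_trm t = {}"

lemma closed_num [simp]: "closed_trm (num n)"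
  by (induction n) (simp_all add: closed_trm_def)

lemma closed_Fn [simp]:
  "closed_trm (Fn f ts) \<longleftrightarrow> wf_sym f \<and> length ts = ar f \<and> (\<forall>t\<in>set ts. closed_trm t)"
  by (auto simp: closed_trm_def)

lemma wf_closed [simp]: "closed_trm t \<Longrightarrow> wf_trm t"
  by (simp add: closed_trm_def)

lemma fv_closed [simp]: "closed_trm t \<Longrightarrow> fv_trm t = {}"
  by (simp add: closed_trm_def)

lemma subst_closed [simp]: "closed_trm t \<Longrightarrow> subst_trm x u t = t"
  by (simp add: subst_trm_fresh)

lemma free_for_closed: "closed_trm t \<Longrightarrow> free_for t x A"
  by (induction A) auto

lemma wf_subst_trm: "wf_trm t \<Longrightarrow> wf_trm u \<Longrightarrow> wf_trm (subst_trm x u t)"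
  by (induction t) auto

lemma provable_subst:
  assumes "T \<turnstile> A" "wf_fm A" "closed_trm t"
  shows "T \<turnstile> subst x t A"
  by (rule provable.MP[OF provable.AllE provable.Gen]) (use assms in \<open>simp_all add: free_for_closed\<close>)

lemma provable_replace:
  assumes "T \<turnstile> Eq s t" "T \<turnstile> subst x s A" "closed_trm s" "closed_trm t" "wf_fm A"
  shows "T \<turnstile> subst x t A"
  by (rule provable.MP[OF provable.MP[OF provable.Leibniz]])
    (use assms in \<open>simp_all add: free_for_closed\<close>)

lemma provable_Eq_trans:
  assumes "T \<turnstile> Eq s t" "T \<turnstile> Eq t u" "closed_trm s" "closed_trm t" "closed_trm u"
  shows "T \<turnstile> Eq s u"
  using provable_replace[of T t u 0 "Eq s (Var 0)"] assms by simp

text \<open>Arguments are replaced one at a time from the left; \<open>us\<close> collects those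
  already treated and therefore varies in the induction.\<close>

lemma provable_Fn_cong:
  assumes "list_all2 (\<lambda>s t. T \<turnstile> Eq s t) ss ts" "\<forall>t\<in>set (us @ ss @ ts). closed_trm t"
    and "wf_sym f" "length (us @ ss) = ar f"
  shows "T \<turnstile> Eq (Fn f (us @ ss)) (Fn f (us @ ts))"
  using assms
proof (induction arbitrary: us rule: list_all2_induct)
  case Nil
  then show ?case by (auto intro!: provable.Refl)
next
  case (Cons s ss t ts)
  have l: "length ss = length ts"
    using Cons by (auto dest: list_all2_lengthD)
  have fresh: "map (subst_trm 0 u) vs = vs" if "\<forall>v\<in>set vs. closed_trm v" for u vs
    using that by (simp add: map_idI)
  \<comment> \<open>Variable \<open>0\<close> marks the position to be replaced; all other arguments
    are closed and unaffected by the substitution.\<close>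
  let ?A = "Eq (Fn f (us @ s # ss)) (Fn f (us @ Var 0 # ss))"
  have "T \<turnstile> Eq (Fn f (us @ s # ss)) (Fn f (us @ s # ss))"
    using Cons by (intro provable.Refl) auto
  then have "T \<turnstile> subst 0 s ?A"
    using Cons.prems by (simp add: fresh)
  then have "T \<turnstile> subst 0 t ?A"
    using Cons by (intro provable_replace[OF Cons.hyps(1)]) auto
  then have 1: "T \<turnstile> Eq (Fn f (us @ s # ss)) (Fn f (us @ t # ss))"
    using Cons.prems by (simp add: fresh)
  have 2: "T \<turnstile> Eq (Fn f ((us @ [t]) @ ss)) (Fn f ((us @ [t]) @ ts))"
    using Cons.prems by (intro Cons.IH) auto
  show ?case
    by (rule provable_Eq_trans[OF 1]) (use 2 Cons.prems l in auto)
qed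

section \<open>Numerical instances of the defining equations\<close>

text \<open>Variables below \<open>n\<close> are instantiated successively, as the calculus does.
  For closed \<open>e i\<close> this agrees with simultaneous substitution, since later steps leave
  inserted terms alone.\<close>

fun substs_trm :: "(nat \<Rightarrow> trm) \<Rightarrow> nat \<Rightarrow> trm \<Rightarrow> trm" where
  "substs_trm e 0 t = t"
| "substs_trm e (Suc n) t = subst_trm n (e n) (substs_trm e n t)"

lemma substs_trm_Fn: "substs_trm e n (Fn f ts) = Fn f (map (substs_trm e n) ts)"
  by (induction n) (simp_all add: comp_def)

lemma substs_trm_Var:
  assumes "\<And>i. closed_trm (e i)"
  shows "substs_trm e n (Var i) = (if i < n then e i else Var i)"
  using assms by (induction n) (auto simp: less_Suc_eq)

lemma provable_instance:
  assumes "T \<turnstile> Eq s t" "wf_trm s" "wf_trm t" "\<And>i. closed_trm (e i)"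
  shows "T \<turnstile> Eq (substs_trm e n s) (substs_trm e n t)"
proof -
  have "T \<turnstile> Eq (substs_trm e n s) (substs_trm e n t) \<and>
      wf_trm (substs_trm e n s) \<and> wf_trm (substs_trm e n t)"
  proof (induction n)
    case (Suc n)
    then show ?case
      using provable_subst[of T "Eq (substs_trm e n s) (substs_trm e n t)" "e n" n] assms(4)
      by (simp add: wf_subst_trm)
  qed (use assms in simp)
  then show ?thesis by blast
qed

lemma PA_instance:
  assumes "Eq s t \<in> PA" "wf_trm s" "wf_trm t" "n = length xs"
  shows "PA \<turnstile> Eq (substs_trm (\<lambda>i. num (xs ! i)) n s) (substs_trm (\<lambda>i. num (xs ! i)) n t)"
  using assms by (intro provable_instance provable.Ax) auto

text \<open>The case \<open>k = 0\<close> serves projection and composition, \<open>k = 1\<close>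
  the parameters of a recursion.\<close>

lemma substs_vars:
  "map (substs_trm (\<lambda>i. num (xs ! i)) (length xs)) (map Var [k..<length xs]) = map num (drop k xs)"
  by (rule nth_equalityI) (auto simp: substs_trm_Var)

lemma substs_num: "substs_trm e n (num k) = num k"
  by (induction n) (simp_all add: subst_closed)

text \<open>By induction on the symbol: a numerical instance of the defining equation exposes
  simpler symbols, whose values are inserted by congruence.\<close>

theorem PA_evaluates:
  assumes "wf_sym f" "length xs = ar f"
  shows "PA \<turnstile> Eq (Fn f (map num xs)) (num (pr_eval f xs))"
  using assms
proof (induction f arbitrary: xs)
  case Zero
  then show ?case by (auto intro!: provable.Refl)
next
  case Succ
  then obtain x where "xs = [x]" by (auto simp: length_Suc_conv)
  then show ?case by (auto intro!: provable.Refl)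
next
  case (Proj n i)
  then have "PA \<turnstile> Eq (substs_trm (\<lambda>i. num (xs ! i)) n (Fn (Proj n i) (map Var [0..<n])))
      (substs_trm (\<lambda>i. num (xs ! i)) n (Var i))"
    by (intro PA_instance PA.proj_eq) auto
  with Proj show ?case
    using substs_vars[of xs 0] by (simp add: substs_trm_Fn substs_trm_Var)
next
  case (Comp n g hs)
  let ?ts = "map (\<lambda>h. Fn h (map num xs)) hs"
  let ?ys = "map (\<lambda>h. pr_eval h xs) hs"
  have "PA \<turnstile> Eq (substs_trm (\<lambda>i. num (xs ! i)) n (Fn (Comp n g hs) (map Var [0..<n])))
      (substs_trm (\<lambda>i. num (xs ! i)) n (Fn g (map (\<lambda>h. Fn h (map Var [0..<n])) hs)))"
    using Comp.prems by (intro PA_instance PA.comp_eq) auto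
  then have 1: "PA \<turnstile> Eq (Fn (Comp n g hs) (map num xs)) (Fn g ?ts)"
    using substs_vars[of xs 0] Comp.prems by (simp add: substs_trm_Fn comp_def)
  have "list_all2 (\<lambda>s t. PA \<turnstile> Eq s t) ?ts (map num ?ys)"
    using Comp by (simp add: list_all2_conv_all_nth)
  then have 2: "PA \<turnstile> Eq (Fn g ([] @ ?ts)) (Fn g ([] @ map num ?ys))"
    using Comp.prems by (intro provable_Fn_cong) auto
  have 3: "PA \<turnstile> Eq (Fn g (map num ?ys)) (num (pr_eval g ?ys))"
    using Comp.prems by (intro Comp.IH) auto
  from provable_Eq_trans[OF provable_Eq_trans[OF 1 2[unfolded append_Nil]] 3] Comp.prems
  show ?case by auto
next
  case (Rec g h)
  from Rec.prems(2) obtain y zs where xs: "xs = y # zs" and len: "length zs = ar g"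
    by (auto simp: length_Suc_conv)
  let ?f = "Rec g h" and ?n = "Suc (ar g)" and ?vs = "map Var [1..<Suc (ar g)]"
  have wf: "wf_sym g" "wf_sym h" "ar h = Suc (Suc (ar g))"
    using Rec.prems by auto
  have vs: "map (substs_trm (\<lambda>i. num ((y # zs) ! i)) ?n) ?vs = map num zs" for y
    using substs_vars[of "y # zs" 1] by (simp only: len list.size drop_Suc_Cons drop_0 One_nat_def) simp
  \<comment> \<open>Inner induction on the recursion argument with the parameters \<open>zs\<close>
    fixed.\<close>
  have "PA \<turnstile> Eq (Fn ?f (num y # map num zs)) (num (pr_eval ?f (y # zs)))" for y
  proof (induction y)
    case 0
    have "PA \<turnstile> Eq (substs_trm (\<lambda>i. num ((0 # zs) ! i)) ?n (Fn ?f (num 0 # ?vs)))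
        (substs_trm (\<lambda>i. num ((0 # zs) ! i)) ?n (Fn g ?vs))"
      using Rec.prems len by (intro PA_instance PA.rec_zero refl) auto
    then have 1: "PA \<turnstile> Eq (Fn ?f (num 0 # map num zs)) (Fn g (map num zs))"
      by (simp only: substs_trm_Fn list.map(2) vs substs_num)
    have 2: "PA \<turnstile> Eq (Fn g (map num zs)) (num (pr_eval g zs))"
      using wf len by (intro Rec.IH) auto
    from provable_Eq_trans[OF 1 2] Rec.prems len show ?case by auto
  next
    case (Suc y)
    let ?r = "pr_eval ?f (y # zs)"
    let ?t = "Fn ?f (num y # map num zs)"
    have v0: "substs_trm (\<lambda>i. num ((y # zs) ! i)) ?n (Var 0) = num y"
      by (subst substs_trm_Var) simp_all
    have "PA \<turnstile> Eq (substs_trm (\<lambda>i. num ((y # zs) ! i)) ?n (Fn ?f (Fn Succ [Var 0] # ?vs)))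
        (substs_trm (\<lambda>i. num ((y # zs) ! i)) ?n (Fn h (Var 0 # Fn ?f (Var 0 # ?vs) # ?vs)))"
      using Rec.prems len by (intro PA_instance PA.rec_succ refl) auto
    then have 1: "PA \<turnstile> Eq (Fn ?f (num (Suc y) # map num zs)) (Fn h (num y # ?t # map num zs))"
      by (simp only: substs_trm_Fn list.map vs v0 num.simps)
    \<comment> \<open>Only the recursive call has to be replaced by its value; \<open>num y\<close>
      stays as an untouched prefix.\<close>
    have "list_all2 (\<lambda>s t. PA \<turnstile> Eq s t) (?t # map num zs) (num ?r # map num zs)"
      using Suc.IH by (auto simp: list_all2_same intro!: provable.Refl)
    then have 2: "PA \<turnstile> Eq (Fn h ([num y] @ ?t # map num zs)) (Fn h ([num y] @ num ?r # map num zs))"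
      using Rec.prems len by (intro provable_Fn_cong) auto
    have 3: "PA \<turnstile> Eq (Fn h (map num (y # ?r # zs))) (num (pr_eval h (y # ?r # zs)))"
      using wf len by (intro Rec.IH) auto
    from provable_Eq_trans[OF provable_Eq_trans[OF 1 2[unfolded append_Cons append_Nil]]
        3[unfolded list.map]] Rec.prems len
    show ?case by auto
  qed
  with xs show ?case by simp
qed


section \<open>The provability predicate and the two claims\<close>

lemma eval_num [simp]: "eval_trm e (num n) = n"
  by (induction n) auto

lemma PA_consistent: "\<not> PA \<turnstile> Bot"
  using PA_sound by fastforce

lemma provability_predicate:
  obtains B where "vformula B" "\<And>A. PA \<turnstile> inst B (num (gn A)) \<longleftrightarrow> PA \<turnstile> A"
proof -
  obtain P where P: "prp (\<lambda>e. P (pfst e) (psnd e))" "\<And>n. provC n \<longleftrightarrow> (\<exists>t. P t n)"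
    using re_provC unfolding re_def by blast
  have "pr2 (\<lambda>t n. of_bool (P t n))"
    using pr2_comp[OF P(1)[unfolded prp_def] pr2_prod_encode] by simp
  then obtain f where f: "wf_sym f" "ar f = 2" "\<And>t n. pr_eval f [t, n] = of_bool (P t n)"
    unfolding pr2_def by blast
  define E where "E s t = Eq (Fn f [s, t]) (num 1)" for s t
  \<comment> \<open>The existential quantifier is a negated universal one; variable \<open>1\<close>
    is the witness and variable \<open>0\<close> is \<open>v\<close>.\<close>
  define B where "B = Imp (All 1 (Imp (E (Var 1) (Var 0)) Bot)) Bot"
  have "vformula B"
    using f by (auto simp: vformula_def B_def E_def)
  moreover have "PA \<turnstile> inst B (num (gn A)) \<longleftrightarrow> PA \<turnstile> A" for A
  proof -
    let ?n = "gn A"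
    let ?C = "Imp (E (Var 1) (num ?n)) Bot"
    have inst: "inst B (num ?n) = Imp (All 1 ?C) Bot"
      by (simp add: B_def E_def)
    show ?thesis
    proof
      assume "PA \<turnstile> inst B (num ?n)"
      then have "sat (\<lambda>_. 0) (Imp (All 1 ?C) Bot)"
        unfolding inst by (rule PA_sound)
      then have "\<exists>t. P t ?n"
        by (auto simp: E_def f(3) of_bool_def split: if_splits)
      then show "PA \<turnstile> A"
        by (simp only: P(2)[symmetric] provC_iff)
    next
      assume "PA \<turnstile> A"
      then obtain t where "P t ?n"
        using P(2) provC_iff by blast
      with PA_evaluates[of f "[t, ?n]"] f have E: "PA \<turnstile> E (num t) (num ?n)"
        by (simp add: E_def)
      have wf: "wf_fm ?C" "wf_fm (E (num t) (num ?n))"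
        using f by (simp_all add: E_def)
      \<comment> \<open>The universal statement implies both the instance at \<open>t\<close> and
        its negation; axiom \<open>S\<close> combines these to \<open>Bot\<close>.\<close>
      have "PA \<turnstile> Imp (All 1 ?C) (subst 1 (num t) ?C)"
        using wf by (intro provable.AllE free_for_closed) simp_all
      then have "PA \<turnstile> Imp (All 1 ?C) (Imp (E (num t) (num ?n)) Bot)"
        by (simp add: E_def)
      moreover have "PA \<turnstile> Imp (All 1 ?C) (E (num t) (num ?n))"
        using E wf by (intro provable.MP[OF provable.K]) simp_all
      moreover have "PA \<turnstile> Imp (Imp (All 1 ?C) (Imp (E (num t) (num ?n)) Bot))
          (Imp (Imp (All 1 ?C) (E (num t) (num ?n))) (Imp (All 1 ?C) Bot))"
        using wf by (intro provable.S) simp_all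
      ultimately show "PA \<turnstile> inst B (num ?n)"
        unfolding inst using provable.MP by blast
    qed
  qed
  ultimately show ?thesis by (rule that)
qed

section \<open>Sentences and truth in the model\<close>

lemma Pred_PA_subset: "H \<in> Pred_PA \<Longrightarrow> H \<in> lists Sigma_PA"
  by (auto simp: Pred_PA_def Sigma_PA_def)

lemma LetA_Pred: "vformula A \<Longrightarrow> [LetA (gn A)] \<in> Pred_PA"
  unfolding Pred_PA_def \<Gamma>_def by (auto intro!: exI[of _ 0])

lemma True_set_iff: "W \<in> True_set M_PA \<longleftrightarrow> W \<in> Sent_PA \<and> PA \<turnstile> J_PA W"
  by (auto simp: True_set_def M_PA_def Phi_PA_def Sent_PA_def)

lemma not_T_Tarski_plus: "\<not> T_Tarski_plus M_PA"
proof -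
  obtain B where B: "vformula B" "\<And>A. PA \<turnstile> inst B (num (gn A)) \<longleftrightarrow> PA \<turnstile> A"
    by (rule provability_predicate) blast
  let ?H = "[LetA (gn B)]"
  have "W \<in> True_plus M_PA \<longleftrightarrow> W \<in> Phi_PA ?H \<inter> Sent_plus M_PA" for W
  proof (cases "W \<in> Sent_plus M_PA")
    case True
    then have W: "W \<in> Sent_PA - Pred_PA"
      by (simp add: Sent_plus_def Sent_M_PA) (simp add: M_PA_def)
    then have "W \<in> lists Sigma_PA"
      by (auto simp: Sent_PA_def dest!: Pred_PA_subset)
    \<comment> \<open>On \<open>Sent_PA - Pred_PA\<close> the letter of \<open>B\<close> is applied
      to the code of \<open>J_PA W\<close>, where \<open>B\<close> expresses provability.\<close>
    moreover have "PA \<turnstile> J_PA (?H @ W) \<longleftrightarrow> PA \<turnstile> J_PA W"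
      using J_Sent_plus(1)[OF W, of "gn B"] B by simp
    ultimately show ?thesis
      using True W by (simp add: True_plus_def True_set_iff Phi_PA_def)
  qed (simp add: True_plus_def)
  moreover have "?H \<in> Pred M_PA"
    using LetA_Pred[OF B(1)] by (simp add: M_PA_def)
  moreover have "Phi M_PA ?H = Phi_PA ?H"
    by (simp add: M_PA_def)
  ultimately show ?thesis
    unfolding T_Tarski_plus_def by blast
qed

lemma T_Tarski_M_PA: "T_Tarski M_PA"
  unfolding T_Tarski_def
proof
  assume "\<exists>H\<in>Pred M_PA. Phi M_PA H = True_set M_PA"
  then obtain H where "H \<in> Pred_PA" and "Phi_PA H = True_set M_PA"
    by (auto simp: M_PA_def)
  then have H: "X \<in> lists Sigma_PA \<and> PA \<turnstile> J_PA (H @ X) \<longleftrightarrow> X \<in> Sent_PA \<and> PA \<turnstile> J_PA X" for X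
    by (auto simp flip: True_set_iff simp: Phi_PA_def)
  obtain j i where ji: "H = replicate j LetR @ [LetA i]"
    using \<open>H \<in> Pred_PA\<close> by (auto simp: Pred_PA_def)
  define A where "A = Eq (num 0) (num 0)"
  let ?a = "LetA (gn A)"
  have A: "vformula A" "inst A t = A" for t
    by (auto simp: A_def vformula_def)
  have "PA \<turnstile> A"
    unfolding A_def by (rule provable.Refl) simp
  have a: "[?a] \<in> Pred_PA" "[LetR, ?a] \<in> Pred_PA"
    using A unfolding Pred_PA_def \<Gamma>_def
    by (auto intro: exI[of _ "0::nat"] exI[of _ "Suc 0"])
  \<comment> \<open>All three clauses for a leading letter are instances of \<open>A\<close>, which
    substitution leaves unchanged.\<close>
  have J_a: "J_PA (?a # X) = A" for X
    by (simp add: A)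
  have Sent_a: "?a # X \<in> Sent_PA" if "X \<in> lists Sigma_PA" for X
    unfolding Sent_PA_def using a(1) that
    by (intro CollectI exI[of _ "[?a]"] exI[of _ X]) simp
  show False
  proof (cases j)
    case 0
    \<comment> \<open>\<open>A\<close> is closed, so \<open>I\<close> identifies \<open>a\<close> and \<open>r a\<close>, but only the first of them is true.\<close>
    have "J_PA (H @ [?a]) = J_PA (H @ [LetR, ?a])"
      using \<open>H \<in> Pred_PA\<close> a by (simp add: J_Pred A)
    \<comment> \<open>After the predicate the empty string remains, and this is not in
      \<open>Pred_PA\<close>.\<close>
    moreover have "J_PA [LetR, ?a] = Bot"
      by (auto simp: Pred_PA_def)
    moreover have "[?a] \<in> lists Sigma_PA" "[LetR, ?a] \<in> lists Sigma_PA"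
      using a Pred_PA_subset by blast+
    ultimately show False
      using H[of "[?a]"] H[of "[LetR, ?a]"] J_a[of "[]"] Sent_a[of "[]"] \<open>PA \<turnstile> A\<close> PA_consistent
      by auto
  next
    case (Suc k)
    \<comment> \<open>No sentence outside \<open>Pred\<close> belongs to the left-hand side.\<close>
    have "[?a, ?a] \<in> lists Sigma_PA"
      using Pred_PA_subset[OF a(1)] by simp
    \<comment> \<open>Otherwise the string would have two decompositions, one with empty remainder
      and one with remainder \<open>[?a]\<close>.\<close>
    moreover have "[?a, ?a] \<notin> Pred_PA"
      using decomposition_unique[OF _ a(1), of "[?a, ?a]" "[]" "[?a]"] by auto
    then have "J_PA (H @ [?a, ?a]) = Bot"
      using J_PA.simps(3)[of "replicate k LetR @ [LetA i] @ [?a, ?a]"] split_pred_append[OF \<open>H \<in> Pred_PA\<close>, of "[?a, ?a]"]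
      by (auto simp: ji Suc split: prod.splits)
    ultimately show False
      using H[of "[?a, ?a]"] J_a[of "[?a]"] Sent_a[of "[?a]"] Pred_PA_subset[OF a(1)]
        \<open>PA \<turnstile> A\<close> PA_consistent by auto
  qed
qed

theorem theorem5p16:
  shows "\<not> T_Tarski_plus M_PA \<and> T_Tarski M_PA"
  using not_T_Tarski_plus T_Tarski_M_PA by blast

end
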